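(* Let $d \ge 1$. For each $f \in H^2_d$, there exists a Borel set $E \subset \partial \mathbb{B}_d$ of outer $H^2_d$-capacity zero, i.e. $\operatorname{cap}^*_{H^2_d}(E) = 0$, such that $f$ has a Korányi limit at every point of $\partial \mathbb{B}_d \setminus E$.
   Context: $\mathbb{B}_d$ is the open Euclidean unit ball of $\mathbb{C}^d$, with boundary sphere $\partial\mathbb{B}_d$. The Drury--Arveson space $H^2_d$ is the reproducing kernel Hilbert space of holomorphic functions on $\mathbb{B}_d$ with kernel $K(z,w) = \frac{1}{1 - \langle z,w\rangle}$. Korányi limit: for $\alpha > 1$ and $\zeta \in \partial\mathbb{B}_d$ let $D_\alpha(\zeta) = \{z \in \mathbb{B}_d : |1 - \langle z,\zeta\rangle| < \frac{\alpha}{2}(1 - \|z\|^2)\}$. A function $f \in C(\mathbb{B}_d)$ has Korányi limit $\lambda \in \mathbb{C}$ at $\zeta$ if for every $\alpha > 1$, $\lim_{z \to \zeta,\, z \in D_\alpha(\zeta)} f(z) = \lambda$. Energy and capacity: the $H^2_d$-energy of a Borel probability measure $\mu$ on $\partial\mathbb{B}_d$ is $$\mathcal{E}(\mu) = \sup_{0 \le r < 1} \int_{\partial\mathbb{B}_d}\int_{\partial\mathbb{B}_d} \operatorname{Re} K(rz,rw)\, d\mu(w)\, d\mu(z) \in [0,\infty].$$ For compact $F \subset \partial\mathbb{B}_d$, $\operatorname{cap}_{H^2_d}(F) = \sup\{1/\mathcal{E}(\mu) : \mu$ a Borel probability measure supported on $F\}$ (with $1/\infty = 0$ and $\operatorname{cap}(\emptyset)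 = 0$). For arbitrary $E \subset \partial\mathbb{B}_d$, the inner capacity is $\operatorname{cap}_{H^2_d}(E) = \sup\{\operatorname{cap}_{H^2_d}(F) : F \subset E \text{ compact}\}$ and the outer capacity is $\operatorname{cap}^*_{H^2_d}(E) = \inf\{\operatorname{cap}_{H^2_d}(G) : G \supset E,\ G \text{ open in } \partial\mathbb{B}_d\}$. *)

theory Defs
  imports "HOL-Analysis.Analysis" "HOL-Probability.Probability"
begin

text \<open>
  The space \<open>\<complex>\<^sup>d\<close> is \<open>complex ^ 'd\<close> with \<open>d = CARD('d) \<ge> 1\<close>. Its library norm is the Euclidean one,
  so the open unit ball and its boundary are \<open>ball 0 1\<close> and \<open>sphere 0 1\<close>.
\<close>

definition cinner :: "complex ^ 'd \<Rightarrow> complex ^ 'd \<Rightarrow> complex"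
  where "cinner z w = (\<Sum>i\<in>UNIV. z $ i * cnj (w $ i))"

definition da_kernel :: "complex ^ 'd \<Rightarrow> complex ^ 'd \<Rightarrow> complex"
  where "da_kernel z w = 1 / (1 - cinner z w)"

text \<open>Complex Frechet differentiability at every point; used for open \<open>S\<close>.\<close>

definition holomorphic_on_vec :: "(complex ^ 'd \<Rightarrow> complex) \<Rightarrow> (complex ^ 'd) set \<Rightarrow> bool"
  where "holomorphic_on_vec f S \<longleftrightarrow>
    (\<forall>z\<in>S. \<exists>L. (f has_derivative L) (at z) \<and> (\<forall>c v. L (c *s v) = c * L v))"

text \<open>
  A reproducing kernel Hilbert space \<open>H\<close> of complex functions on \<open>X\<close>. A function on \<open>X\<close> is represented
  by its extension by zero to the whole type. The inner product is linear in the first argument.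
\<close>

locale rkhs =
  fixes X :: "'a set"
    and K :: "'a \<Rightarrow> 'a \<Rightarrow> complex"
    and H :: "('a \<Rightarrow> complex) set"
    and ip :: "('a \<Rightarrow> complex) \<Rightarrow> ('a \<Rightarrow> complex) \<Rightarrow> complex"
  assumes vanish_outside: "\<And>f x. f \<in> H \<Longrightarrow> x \<notin> X \<Longrightarrow> f x = 0"
    and zero_mem: "(\<lambda>x. 0) \<in> H"
    and add_mem: "\<And>f g. f \<in> H \<Longrightarrow> g \<in> H \<Longrightarrow> (\<lambda>x. f x + g x) \<in> H"
    and scale_mem: "\<And>c f. f \<in> H \<Longrightarrow> (\<lambda>x. c * f x) \<in> H"
    and ip_add_left: "\<And>f g h. f \<in> H \<Longrightarrow> g \<in> H \<Longrightarrow> h \<in> H \<Longrightarrow>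
          ip (\<lambda>x. f x + g x) h = ip f h + ip g h"
    and ip_scale_left: "\<And>c f h. f \<in> H \<Longrightarrow> h \<in> H \<Longrightarrow> ip (\<lambda>x. c * f x) h = c * ip f h"
    and ip_cnj: "\<And>f g. f \<in> H \<Longrightarrow> g \<in> H \<Longrightarrow> ip g f = cnj (ip f g)"
    and ip_nonneg: "\<And>f. f \<in> H \<Longrightarrow> 0 \<le> Re (ip f f)"
    and ip_definite: "\<And>f. f \<in> H \<Longrightarrow> ip f f = 0 \<Longrightarrow> f = (\<lambda>x. 0)"
    and complete: "Metric_space.mcomplete H
          (\<lambda>f g. sqrt (Re (ip (\<lambda>x. f x - g x) (\<lambda>x. f x - g x))))"
    and kernel_mem: "\<And>w. w \<in> X \<Longrightarrow> (\<lambda>z. if z \<in> X then K z w else 0) \<in> H"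
    and reproducing: "\<And>f w. f \<in> H \<Longrightarrow> w \<in> X \<Longrightarrow>
          f w = ip f (\<lambda>z. if z \<in> X then K z w else 0)"

text \<open>
  A reproducing kernel Hilbert space is determined by its kernel (Moore--Aronszajn), so the
  existential quantifier over \<open>H\<close> and \<open>ip\<close> refers to a single space.
\<close>

definition drury_arveson :: "(complex ^ 'd \<Rightarrow> complex) set"
  where "drury_arveson = {f. \<exists>H ip. rkhs (ball 0 1) da_kernel H ip \<and>
    (\<forall>g\<in>H. holomorphic_on_vec g (ball 0 1)) \<and> f \<in> H}"

definition koranyi_region :: "real \<Rightarrow> complex ^ 'd \<Rightarrow> (complex ^ 'd) set"
  where "koranyi_region \<alpha> \<zeta> =
    {z \<in> ball 0 1. cmod (1 - cinner z \<zeta>) < \<alpha> / 2 * (1 - (norm z)\<^sup>2)}"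

definition has_koranyi_limit :: "(complex ^ 'd \<Rightarrow> complex) \<Rightarrow> complex \<Rightarrow> complex ^ 'd \<Rightarrow> bool"
  where "has_koranyi_limit f l \<zeta> \<longleftrightarrow>
    continuous_on (ball 0 1) f \<and>
    (\<forall>\<alpha>>1. (f \<longlongrightarrow> l) (at \<zeta> within koranyi_region \<alpha> \<zeta>))"

definition sphere_prob_measures :: "(complex ^ 'd) measure set"
  where "sphere_prob_measures =
    {\<mu>. prob_space \<mu> \<and> sets \<mu> = sets (restrict_space borel (sphere 0 1))}"

text \<open>
  The double integrals are positive, because \<open>Re (1 / (1 - u)) \<ge> 1/2\<close> for \<open>cmod u < 1\<close>, so
  \<open>ennreal\<close> does not truncate them.
\<close>

definition energy :: "(complex ^ 'd) measure \<Rightarrow> ennreal"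
  where "energy \<mu> = (SUP r\<in>{0..<1}.
    ennreal (\<integral>z. (\<integral>w. Re (da_kernel (r *\<^sub>R z) (r *\<^sub>R w)) \<partial>\<mu>) \<partial>\<mu>))"

text \<open>In \<^typ>\<open>ennreal\<close>, \<open>1 / \<infinity> = 0\<close> and the supremum of the empty set is \<open>0\<close>.\<close>

definition cap_compact :: "(complex ^ 'd) set \<Rightarrow> ennreal"
  where "cap_compact F =
    (SUP \<mu>\<in>{\<mu> \<in> sphere_prob_measures. emeasure \<mu> (sphere 0 1 - F) = 0}. 1 / energy \<mu>)"

definition inner_cap :: "(complex ^ 'd) set \<Rightarrow> ennreal"
  where "inner_cap E = (SUP F\<in>{F. compact F \<and> F \<subseteq> E}. cap_compact F)"

definition outer_cap :: "(complex ^ 'd) set \<Rightarrow> ennreal"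
  where "outer_cap E =
    (INF G\<in>{G. openin (top_of_set (sphere 0 1)) G \<and> E \<subseteq> G}. inner_cap G)"

end

theory Submission
  imports Defs
begin

text \<open>
  The theorem follows from a capacitary weak-type inequality for the Koranyi maximal function. If
  \<open>Re h > t\<close> at points \<open>z i\<close> of the Koranyi regions over a fine partition with \<open>\<mu>\<close>-masses \<open>m i\<close>, then
  pairing \<open>h\<close> with \<open>\<Sum>i. m i * K(_, z i)\<close> gives \<open>t * \<mu>(G) \<le> \<parallel>h\<parallel> * sqrt A\<close> with
  \<open>A = \<Sum>i j. m i * m j * Re K(z i, z j)\<close>. Taking real parts matters: \<open>\<bar>K\<bar>\<close> is not dominated by \<open>Re K\<close>.
  With \<open>v i\<close> in the \<open>i\<close>-th cell on a sphere of radius close to 1, an elementary Harnack inequality for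
  \<open>Re K\<close>, applied to whichever of \<open>z i\<close>, \<open>z j\<close> is nearer to the boundary, gives
  \<open>Re K(z i, z j) \<le> C * (Re K(z i, v j) + Re K(v i, z j))\<close>. By Cauchy--Schwarz \<open>A \<le> 2 * C * sqrt (A * B)\<close>,
  where \<open>B = \<Sum>i j. m i * m j * Re K(v i, v j)\<close> is controlled by the energy of \<open>\<mu>\<close>; hence \<open>A \<le> 4 * C\<^sup>2 * B\<close>.
  Approximating \<open>f\<close> by combinations of kernel functions, which extend continuously to the sphere, the
  exceptional sets get small capacity.
\<close>

section \<open>The Hermitian form on \<open>complex ^ 'd\<close>\<close>

lemma cinner_diff_left: "cinner (x - y) z = cinner x z - cinner y z"
  by (simp add: cinner_def algebra_simps sum_subtractf)

lemma cinner_diff_right: "cinner z (x - y) = cinner z x - cinner z y"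
  by (simp add: cinner_def algebra_simps sum_subtractf)

lemma cinner_scaleR_left: "cinner (r *\<^sub>R x) y = of_real r * cinner x y"
  unfolding cinner_def vector_scaleR_component
  by (simp add: scaleR_conv_of_real sum_distrib_left mult_ac)

lemma cinner_scaleR_right: "cinner x (r *\<^sub>R y) = of_real r * cinner x y"
  unfolding cinner_def vector_scaleR_component
  by (simp add: scaleR_conv_of_real sum_distrib_left mult_ac)

lemma cnj_cinner: "cnj (cinner z w) = cinner w z"
  by (simp add: cinner_def mult.commute)

lemma Re_cinner: "Re (cinner z w) = z \<bullet> w"
  by (simp add: cinner_def inner_vec_def inner_complex_def)

lemma cinner_self: "cinner z z = of_real ((norm z)\<^sup>2)"
  by (rule complex_eqI)
     (auto simp: Re_cinner power2_norm_eq_inner, auto simp: cinner_def)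

lemma norm_cinner_le: "cmod (cinner z w) \<le> norm z * norm w"
proof -
  have "cmod (cinner z w) \<le> (\<Sum>i\<in>UNIV. \<bar>cmod (z $ i)\<bar> * \<bar>cmod (w $ i)\<bar>)"
    unfolding cinner_def by (rule sum_norm_le) (simp add: norm_mult)
  also have "\<dots> \<le> norm z * norm w"
    unfolding norm_vec_def by (rule L2_set_mult_ineq)
  finally show ?thesis .
qed

lemma continuous_on_cinner [continuous_intros]:
  assumes "continuous_on S f" "continuous_on S g"
  shows "continuous_on S (\<lambda>x. cinner (f x) (g x))"
  unfolding cinner_def by (intro continuous_intros assms)

section \<open>Positivity of \<open>Re K\<close> and its Harnack inequality\<close>

text \<open>Polarisation. On the closed ball the three terms on the right are nonnegative, so each
  is at most \<open>2 * cmod (1 - cinner z w)\<close>; the Harnack estimate rests on this.\<close>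

lemma Re_one_minus_cinner:
  "2 * Re (1 - cinner z w) = (norm (z - w))\<^sup>2 + (1 - (norm z)\<^sup>2) + (1 - (norm w)\<^sup>2)"
  by (simp add: Re_cinner power2_norm_eq_inner inner_diff inner_commute)

lemma Re_da_kernel: "Re (da_kernel z w) = Re (1 - cinner z w) / (cmod (1 - cinner z w))\<^sup>2"
  by (simp add: da_kernel_def Re_divide cmod_power2)

lemma Re_da_kernel_commute: "Re (da_kernel z w) = Re (da_kernel w z)"
proof -
  have "da_kernel w z = cnj (da_kernel z w)"
    by (simp add: da_kernel_def cnj_cinner)
  then show ?thesis by simp
qed

lemma Re_da_kernel_nonneg:
  assumes "norm z \<le> 1" "norm w \<le> 1"
  shows "0 \<le> Re (da_kernel z w)"
proof -
  have "0 \<le> 2 * Re (1 - cinner z w)"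
    unfolding Re_one_minus_cinner using assms power_le_one[of "norm z" 2] power_le_one[of "norm w" 2]
    by (intro add_nonneg_nonneg) auto
  then show ?thesis by (simp add: Re_da_kernel)
qed

text \<open>
  The point of the hypothesis: \<open>w\<close> and \<open>v\<close> may differ by the square root of \<open>1 - \<parallel>z\<parallel>\<^sup>2\<close> in
  complex tangential directions, yet their kernels at \<open>z\<close> are comparable.
\<close>

lemma Re_da_kernel_Harnack:
  fixes z w v :: "complex ^ 'd"
  assumes z: "norm z < 1" and w: "norm w < 1" and v: "norm v \<le> 1"
    and M: "cmod (1 - cinner w v) \<le> M * (1 - (norm z)\<^sup>2)"
  shows "Re (da_kernel z w) \<le> (6 * M + 2) * (8 * M + 2)\<^sup>2 * Re (da_kernel z v)"
proof -
  define dz dw dv where "dz = 1 - (norm z)\<^sup>2" and "dw = 1 - (norm w)\<^sup>2" and "dv = 1 - (norm v)\<^sup>2"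
  define a b where "a = 1 - cinner z w" and "b = 1 - cinner z v"
  have dz: "dz > 0" and dw: "dw > 0" and dv: "dv \<ge> 0"
    using z w v by (auto simp: dz_def dw_def dv_def power_le_one abs_square_less_1)
  have M0: "0 \<le> M"
  proof -
    have "0 \<le> M * dz"
      using M norm_ge_zero[of "1 - cinner w v"] unfolding dz_def by linarith
    then show ?thesis
      using dz by (simp add: zero_le_mult_iff)
  qed
  have Ra: "2 * Re a = (norm (z - w))\<^sup>2 + dz + dw"
    unfolding a_def dz_def dw_def by (rule Re_one_minus_cinner)
  have Rb: "2 * Re b = (norm (z - v))\<^sup>2 + dz + dv"
    unfolding b_def dz_def dv_def by (rule Re_one_minus_cinner)
  have Rwv: "2 * Re (1 - cinner w v) = (norm (w - v))\<^sup>2 + dw + dv"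
    unfolding dw_def dv_def by (rule Re_one_minus_cinner)
  have Mdz: "Re (1 - cinner w v) \<le> M * dz"
    using M complex_Re_le_cmod[of "1 - cinner w v"] unfolding dz_def by linarith
  have wv: "(norm (w - v))\<^sup>2 \<le> 2 * M * dz" "dw \<le> 2 * M * dz"
    using Rwv Mdz dw dv zero_le_power2[of "norm (w - v)"] by linarith+
  have "norm (z - w) \<le> norm (z - v) + norm (w - v)"
    using dist_triangle2[of z w v] by (simp add: dist_norm)
  then have "(norm (z - w))\<^sup>2 \<le> (norm (z - v) + norm (w - v))\<^sup>2"
    by (simp add: power_mono)
  also have "\<dots> \<le> 2 * (norm (z - v))\<^sup>2 + 2 * (norm (w - v))\<^sup>2"
    using zero_le_power2[of "norm (z - v) - norm (w - v)"]
    by (simp add: power2_eq_square algebra_simps)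
  finally have zw: "(norm (z - w))\<^sup>2 \<le> 2 * (norm (z - v))\<^sup>2 + 4 * M * dz"
    using wv by linarith
  \<comment> \<open>\<open>Re K\<close> is the quotient \<open>Re a / (cmod a)\<^sup>2\<close>. Real
    parts are compared first, with ratio \<open>6 * M + 2\<close>, then moduli, with ratio
    \<open>8 * M + 2\<close>; the second ratio enters squared.\<close>
  have "2 * Re a \<le> 2 * (norm (z - v))\<^sup>2 + (6 * M + 1) * dz"
    using Ra zw wv by (simp add: algebra_simps)
  also have "\<dots> \<le> (6 * M + 2) * ((norm (z - v))\<^sup>2 + dz)"
    using M0 dz by (simp add: algebra_simps)
  also have "\<dots> \<le> (6 * M + 2) * (2 * Re b)"
    using Rb dv M0 by (intro mult_left_mono) auto
  finally have ReLe: "Re a \<le> (6 * M + 2) * Re b" by simp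
  have Ra': "2 * Re a \<le> 2 * cmod a"
    using complex_Re_le_cmod[of a] by simp
  have dza: "dz \<le> 2 * cmod a"
    using Ra Ra' dw zero_le_power2[of "norm (z - w)"] by linarith
  have Mdza: "M * dz \<le> 2 * M * cmod a"
    using mult_left_mono[OF dza M0] by simp
  have zwa: "(norm (z - w))\<^sup>2 \<le> 2 * cmod a"
    using Ra Ra' dw dz by linarith
  \<comment> \<open>The first correction is a product of two displacements, each of the order of a
    square root, and AM-GM makes it linear in \<open>cmod a\<close>. The second pairs a displacement
    with \<open>w\<close> itself and needs the hypothesis on \<open>w\<close> and
    \<open>v\<close>.\<close>
  have "b = a - cinner (z - w) (v - w) - cinner w (v - w)"
    by (simp add: a_def b_def cinner_diff_left cinner_diff_right)
  then have "cmod b \<le> cmod a + cmod (cinner (z - w) (v - w)) + cmod (cinner w (v - w))"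
    using norm_triangle_ineq4[of "a - cinner (z - w) (v - w)" "cinner w (v - w)"]
      norm_triangle_ineq4[of a "cinner (z - w) (v - w)"] by simp
  moreover have "cmod (cinner (z - w) (v - w)) \<le> (1 + 2 * M) * cmod a"
  proof -
    have "cmod (cinner (z - w) (v - w)) \<le> norm (z - w) * norm (w - v)"
      using norm_cinner_le[of "z - w" "v - w"] by (simp add: norm_minus_commute)
    also have "\<dots> \<le> ((norm (z - w))\<^sup>2 + (norm (w - v))\<^sup>2) / 2"
      using zero_le_power2[of "norm (z - w) - norm (w - v)"]
      by (simp add: power2_eq_square algebra_simps)
    also have "\<dots> \<le> (1 + 2 * M) * cmod a"
      using zwa wv Mdza by (simp add: algebra_simps)
    finally show ?thesis .
  qed
  moreover have "cmod (cinner w (v - w)) \<le> 6 * M * cmod a"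
  proof -
    \<comment> \<open>Cauchy--Schwarz would leave \<open>norm (w - v)\<close>, only the square root
      of the required order. The identity brings in \<open>1 - cinner w v\<close>, which the
      hypothesis bounds to first order.\<close>
    have "cinner w (v - w) = of_real dw - (1 - cinner w v)"
      by (simp add: cinner_diff_right cinner_self dw_def)
    then have "cmod (cinner w (v - w)) \<le> dw + cmod (1 - cinner w v)"
      using norm_triangle_ineq4[of "of_real dw" "1 - cinner w v"] dw by simp
    also have "\<dots> \<le> 3 * (M * dz)"
      using M wv unfolding dz_def by linarith
    finally show ?thesis using Mdza by linarith
  qed
  ultimately have mod: "cmod b \<le> (8 * M + 2) * cmod a"
    by (simp add: algebra_simps)
  have a0: "cmod a > 0" and b0: "cmod b > 0" and Rb0: "Re b > 0"
    using dz dza Rb dv complex_Re_le_cmod[of b] zero_le_power2[of "norm (z - v)"] by linarith+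
  have "Re a * (cmod b)\<^sup>2 \<le> ((6 * M + 2) * Re b) * ((8 * M + 2) * cmod a)\<^sup>2"
    using ReLe mod M0 Rb0 by (intro mult_mono power_mono) auto
  also have "\<dots> = ((6 * M + 2) * (8 * M + 2)\<^sup>2 * Re b) * (cmod a)\<^sup>2"
    by (simp only: power_mult_distrib mult_ac)
  finally have "Re a / (cmod a)\<^sup>2 \<le> (6 * M + 2) * (8 * M + 2)\<^sup>2 * (Re b / (cmod b)\<^sup>2)"
    using a0 b0 by (simp add: divide_simps)
  then show ?thesis
    unfolding Re_da_kernel a_def b_def .
qed

section \<open>Reproducing kernel Hilbert spaces and finite kernel sums\<close>

text \<open>Evaluate at the vertex \<open>R / G\<close>. With \<open>F\<close> a squared norm this
  yields Cauchy--Schwarz; with \<open>F\<close> the excess over a minimal squared distance it yields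
  near-orthogonality.\<close>

lemma nonneg_quadratic_discriminant:
  fixes F R G :: real
  assumes "\<And>t. 0 \<le> F - 2 * t * R + t\<^sup>2 * G" "0 \<le> G"
  shows "R\<^sup>2 \<le> F * G"
proof (cases "G = 0")
  case True
  have "R = 0"
  proof (rule ccontr)
    assume "R \<noteq> 0"
    then show False
      \<comment> \<open>For \<open>G = 0\<close> the expression is affine in \<open>t\<close>, and
        this value of \<open>t\<close> makes it \<open>-1\<close>.\<close>
      using assms(1)[of "(F + 1) / (2 * R)"] True by simp
  qed
  then show ?thesis using True by simp
next
  case False
  then have "0 \<le> F - R\<^sup>2 / G"
    using assms(1)[of "R / G"] by (simp add: power2_eq_square)
  then show ?thesis
    using False assms(2) by (simp add: field_simps)
qed

context rkhs
begin

definition kfun :: "'a \<Rightarrow> 'a \<Rightarrow> complex"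
  where "kfun w = (\<lambda>z. if z \<in> X then K z w else 0)"

definition nrm :: "('a \<Rightarrow> complex) \<Rightarrow> real"
  where "nrm f = sqrt (Re (ip f f))"

lemma kfun_mem [simp]: "w \<in> X \<Longrightarrow> kfun w \<in> H"
  unfolding kfun_def by (rule kernel_mem)

lemma ip_kfun: "f \<in> H \<Longrightarrow> w \<in> X \<Longrightarrow> ip f (kfun w) = f w"
  using reproducing by (simp add: kfun_def)

lemma diff_mem: "f \<in> H \<Longrightarrow> g \<in> H \<Longrightarrow> (\<lambda>x. f x - g x) \<in> H"
  using add_mem[of f "\<lambda>x. -1 * g x"] scale_mem[of g "-1"] by simp

lemma ip_add_right:
  assumes "f \<in> H" "g \<in> H" "h \<in> H"
  shows "ip h (\<lambda>x. f x + g x) = ip h f + ip h g"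
  using ip_cnj[of "\<lambda>x. f x + g x" h] ip_add_left[of f g h] ip_cnj[of f h] ip_cnj[of g h] assms add_mem
  by simp

lemma ip_scale_right:
  assumes "f \<in> H" "h \<in> H"
  shows "ip h (\<lambda>x. c * f x) = cnj c * ip h f"
  using ip_cnj[of "\<lambda>x. c * f x" h] ip_scale_left[of f h c] ip_cnj[of f h] assms scale_mem
  by simp

lemma ip_diff_left:
  assumes "f \<in> H" "g \<in> H" "h \<in> H"
  shows "ip (\<lambda>x. f x - g x) h = ip f h - ip g h"
  using ip_add_left[of f "\<lambda>x. -1 * g x" h] ip_scale_left[of g h "-1"] scale_mem[of g "-1"] assms
  by simp

lemma ip_diff_right:
  assumes "f \<in> H" "g \<in> H" "h \<in> H"
  shows "ip h (\<lambda>x. f x - g x) = ip h f - ip h g"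
  using ip_add_right[of f "\<lambda>x. -1 * g x" h] ip_scale_right[of g h "-1"] scale_mem[of g "-1"] assms
  by simp

lemma nrm_nonneg: "f \<in> H \<Longrightarrow> 0 \<le> nrm f"
  by (simp add: nrm_def ip_nonneg)

lemma nrm_power2: "f \<in> H \<Longrightarrow> (nrm f)\<^sup>2 = Re (ip f f)"
  by (simp add: nrm_def ip_nonneg)

lemma nrm_scale:
  assumes "f \<in> H"
  shows "nrm (\<lambda>x. c * f x) = cmod c * nrm f"
proof -
  have "ip (\<lambda>x. c * f x) (\<lambda>x. c * f x) = c * cnj c * ip f f"
    using assms by (simp add: ip_scale_left ip_scale_right scale_mem)
  also have "c * cnj c = of_real ((cmod c)\<^sup>2)"
    by (rule complex_norm_square[symmetric])
  finally show ?thesis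
    by (simp add: nrm_def real_sqrt_mult)
qed

lemma nrm_power2_diff_scale:
  assumes "f \<in> H" "g \<in> H"
  shows "(nrm (\<lambda>x. f x - of_real t * g x))\<^sup>2 = (nrm f)\<^sup>2 - 2 * t * Re (ip f g) + t\<^sup>2 * (nrm g)\<^sup>2"
proof -
  have [simp]: "(\<lambda>x. of_real t * g x) \<in> H" "(\<lambda>x. f x - of_real t * g x) \<in> H"
    using assms by (auto intro: scale_mem diff_mem)
  have "Re (ip g f) = Re (ip f g)"
    using ip_cnj[of f g] assms by simp
  then show ?thesis
    using assms by (simp add: nrm_power2 ip_diff_left ip_diff_right ip_scale_left ip_scale_right
        right_diff_distrib power2_eq_square[of t])
qed

lemma Re_ip_power2_le:
  assumes "f \<in> H" "g \<in> H"
  shows "(Re (ip f g))\<^sup>2 \<le> (nrm f)\<^sup>2 * (nrm g)\<^sup>2"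
proof (rule nonneg_quadratic_discriminant)
  show "0 \<le> (nrm f)\<^sup>2 - 2 * t * Re (ip f g) + t\<^sup>2 * (nrm g)\<^sup>2" for t
    using nrm_power2_diff_scale[OF assms, of t] by (metis zero_le_power2)
qed simp

lemma Re_ip_le:
  assumes "f \<in> H" "g \<in> H"
  shows "Re (ip f g) \<le> nrm f * nrm g"
  by (rule power2_le_imp_le)
     (use Re_ip_power2_le[OF assms] nrm_nonneg assms in \<open>simp_all add: power_mult_distrib\<close>)

text \<open>A near-minimiser of the distance to \<open>S\<close> replaces the orthogonal projection, so no completeness enters.\<close>

lemma almost_orthogonal:
  assumes S: "S \<subseteq> H" "(\<lambda>x. 0) \<in> S"
    and add: "\<And>g h. g \<in> S \<Longrightarrow> h \<in> S \<Longrightarrow> (\<lambda>x. g x + h x) \<in> S"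
    and scale: "\<And>c g. g \<in> S \<Longrightarrow> (\<lambda>x. c * g x) \<in> S"
    and f: "f \<in> H" and e: "0 < e"
  shows "\<exists>g\<in>S. \<forall>s\<in>S. Re (ip (\<lambda>x. f x - g x) s) \<le> e * nrm s"
proof -
  define D where "D = (INF g\<in>S. (nrm (\<lambda>x. f x - g x))\<^sup>2)"
  have bdd: "bdd_below ((\<lambda>g. (nrm (\<lambda>x. f x - g x))\<^sup>2) ` S)"
    by (rule bdd_belowI[of _ 0]) auto
  \<comment> \<open>An excess of \<open>e\<^sup>2\<close> in the squared distance becomes the factor
    \<open>e\<close> once a square root is taken.\<close>
  have "D < D + e\<^sup>2" using e by simp
  then obtain g where g: "g \<in> S" and gD: "(nrm (\<lambda>x. f x - g x))\<^sup>2 < D + e\<^sup>2"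
    unfolding D_def using cINF_less_iff[OF _ bdd] S by blast
  show ?thesis
  proof (intro bexI ballI)
    fix s assume s: "s \<in> S"
    let ?h = "\<lambda>x. f x - g x"
    have mem: "?h \<in> H" "s \<in> H" using f g s S by (auto intro: diff_mem)
    \<comment> \<open>Moving \<open>g\<close> along \<open>s\<close> stays in \<open>S\<close> and
      cannot bring the squared distance below \<open>D\<close>, so the quadratic in \<open>t\<close>
      with the excess as constant term is nonnegative.\<close>
    have "(Re (ip ?h s))\<^sup>2 \<le> ((nrm ?h)\<^sup>2 - D) * (nrm s)\<^sup>2"
    proof (rule nonneg_quadratic_discriminant)
      fix t :: real
      have "(\<lambda>x. g x + of_real t * s x) \<in> S" using g s add scale by auto
      then have "D \<le> (nrm (\<lambda>x. f x - (g x + of_real t * s x)))\<^sup>2"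
        unfolding D_def by (rule cINF_lower[OF bdd])
      also have "(\<lambda>x. f x - (g x + of_real t * s x)) = (\<lambda>x. ?h x - of_real t * s x)"
        by (simp add: algebra_simps)
      finally show "0 \<le> ((nrm ?h)\<^sup>2 - D) - 2 * t * Re (ip ?h s) + t\<^sup>2 * (nrm s)\<^sup>2"
        unfolding nrm_power2_diff_scale[OF mem] by simp
    qed simp
    also have "\<dots> \<le> e\<^sup>2 * (nrm s)\<^sup>2"
      using gD by (intro mult_right_mono) auto
    finally have "(Re (ip ?h s))\<^sup>2 \<le> (e * nrm s)\<^sup>2"
      by (simp add: power_mult_distrib)
    then show "Re (ip ?h s) \<le> e * nrm s"
      by (rule power2_le_imp_le) (use e nrm_nonneg[OF mem(2)] in simp)
  qed (fact g)
qed

text \<open>For finite \<open>I\<close> and points in \<open>X\<close> this represents the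
  functional taking \<open>f\<close> to \<open>\<Sum>i\<in>I. m i * f (p i)\<close>: it is the
  potential of the discrete measure with masses \<open>m i\<close> at \<open>p i\<close>.\<close>

definition kcomb :: "'i set \<Rightarrow> ('i \<Rightarrow> real) \<Rightarrow> ('i \<Rightarrow> 'a) \<Rightarrow> 'a \<Rightarrow> complex"
  where "kcomb I m p = (\<lambda>x. \<Sum>i\<in>I. of_real (m i) * kfun (p i) x)"

text \<open>The subspace is arbitrary because two are used: \<open>H\<close> itself and the
  functions in \<open>H\<close> with boundary limits.\<close>

lemma kcomb_mem_subspace:
  assumes "finite I" "\<And>i. i \<in> I \<Longrightarrow> kfun (p i) \<in> S" "(\<lambda>x. 0) \<in> S"
    and add: "\<And>g h. g \<in> S \<Longrightarrow> h \<in> S \<Longrightarrow> (\<lambda>x. g x + h x) \<in> S"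
    and scale: "\<And>c g. g \<in> S \<Longrightarrow> (\<lambda>x. c * g x) \<in> S"
  shows "kcomb I m p \<in> S"
  using assms(1,2)
proof (induction I)
  case empty
  then show ?case using assms(3) by (simp add: kcomb_def)
next
  case (insert i I)
  then show ?case
    using add[OF scale[of "kfun (p i)" "of_real (m i)"], of "kcomb I m p"] by (simp add: kcomb_def)
qed

lemma kcomb_mem: "finite I \<Longrightarrow> (\<And>i. i \<in> I \<Longrightarrow> p i \<in> X) \<Longrightarrow> kcomb I m p \<in> H"
  by (rule kcomb_mem_subspace[OF _ _ zero_mem add_mem scale_mem]) simp_all

lemma ip_zero_right: "h \<in> H \<Longrightarrow> ip h (\<lambda>x. 0) = 0"
  using ip_scale_right[OF zero_mem, of h 0] by simp

lemma ip_kcomb: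
  assumes "finite I" "\<And>i. i \<in> I \<Longrightarrow> p i \<in> X" "f \<in> H"
  shows "ip f (kcomb I m p) = (\<Sum>i\<in>I. of_real (m i) * f (p i))"
  using assms(1,2)
proof (induction I)
  case empty
  then show ?case using assms(3) by (simp add: kcomb_def ip_zero_right)
next
  case (insert i I)
  have "kcomb (insert i I) m p = (\<lambda>x. (of_real (m i) * kfun (p i) x) + kcomb I m p x)"
    using insert.hyps by (simp add: kcomb_def)
  then show ?case
    using insert assms(3) by (simp add: ip_add_right scale_mem kcomb_mem ip_scale_right ip_kfun)
qed

text \<open>The mutual energy of two discrete measures. Since the masses are real, only
  \<open>Re K\<close> survives, so Harnack applies term by term.\<close>

lemma Re_ip_kcomb_kcomb:
  assumes "finite I" "\<And>i. i \<in> I \<Longrightarrow> p i \<in> X" "finite J" "\<And>j. j \<in> J \<Longrightarrow> q j \<in> X"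
  shows "Re (ip (kcomb I m p) (kcomb J n q)) = (\<Sum>j\<in>J. \<Sum>i\<in>I. n j * m i * Re (K (q j) (p i)))"
proof -
  have "ip (kcomb I m p) (kcomb J n q) = (\<Sum>j\<in>J. of_real (n j) * kcomb I m p (q j))"
    using assms by (simp add: ip_kcomb kcomb_mem)
  also have "\<dots> = (\<Sum>j\<in>J. \<Sum>i\<in>I. of_real (n j * m i) * K (q j) (p i))"
    unfolding kcomb_def sum_distrib_left
    using assms by (intro sum.cong) (auto simp: kfun_def mult_ac)
  finally show ?thesis by simp
qed

end

section \<open>Moving the poles of a kernel sum\<close>

text \<open>The Harnack constant. It is used with \<open>M = \<alpha> / 2 + 1\<close> for Koranyi
  points and with \<open>M = 2\<close> inside a partition cell.\<close>

definition da_const :: "real \<Rightarrow> real"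
  where "da_const M = (6 * M + 2) * (8 * M + 2)\<^sup>2"

lemma da_const_nonneg: "0 \<le> M \<Longrightarrow> 0 \<le> da_const M"
  by (simp add: da_const_def)

text \<open>Harnack moves one argument when its displacement is small against the defect
  \<open>1 - (norm _)\<^sup>2\<close> of the other. The point of larger norm has the smaller defect,
  so it is the one moved; nonnegativity lets the sum cover both cases.\<close>

lemma Re_da_kernel_le_sum:
  fixes z w v u :: "complex ^ 'd"
  assumes "norm z < 1" "norm w < 1" "norm v < 1" "norm u < 1" "0 \<le> M"
    and "cmod (1 - cinner z v) \<le> M * (1 - (norm z)\<^sup>2)"
    and "cmod (1 - cinner w u) \<le> M * (1 - (norm w)\<^sup>2)"
  shows "Re (da_kernel z w) \<le> da_const M * (Re (da_kernel z u) + Re (da_kernel v w))"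
proof (cases "norm z \<le> norm w")
  case True
  then have "1 - (norm w)\<^sup>2 \<le> 1 - (norm z)\<^sup>2"
    by (simp add: power_mono)
  then have "cmod (1 - cinner w u) \<le> M * (1 - (norm z)\<^sup>2)"
    using assms by (meson mult_left_mono order_trans)
  then have "Re (da_kernel z w) \<le> da_const M * Re (da_kernel z u)"
    unfolding da_const_def using assms by (intro Re_da_kernel_Harnack) auto
  moreover have "0 \<le> da_const M * Re (da_kernel v w)"
    using assms by (intro mult_nonneg_nonneg da_const_nonneg Re_da_kernel_nonneg) auto
  ultimately show ?thesis by (simp add: distrib_left)
next
  case False
  then have "1 - (norm z)\<^sup>2 \<le> 1 - (norm w)\<^sup>2"
    by (simp add: power_mono)
  then have "cmod (1 - cinner z v) \<le> M * (1 - (norm w)\<^sup>2)"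
    using assms by (meson mult_left_mono order_trans)
  then have "Re (da_kernel w z) \<le> da_const M * Re (da_kernel w v)"
    unfolding da_const_def using assms by (intro Re_da_kernel_Harnack) auto
  moreover have "0 \<le> da_const M * Re (da_kernel z u)"
    using assms by (intro mult_nonneg_nonneg da_const_nonneg Re_da_kernel_nonneg) auto
  ultimately show ?thesis
    by (simp add: distrib_left Re_da_kernel_commute[of w z] Re_da_kernel_commute[of w v])
qed

text \<open>
  Bounding the quadratic form at the \<open>z i\<close> by the mixed one brings it back under a square root by
  Cauchy--Schwarz, so it can be absorbed. No maximal theorem is used.
\<close>

lemma nrm_kcomb_le:
  fixes z v :: "'i \<Rightarrow> complex ^ 'd"
  assumes rk: "rkhs (ball 0 1) da_kernel H ip"
    and I: "finite I" "\<And>i. i \<in> I \<Longrightarrow> 0 \<le> m i" and M: "0 \<le> M"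
    and z: "\<And>i. i \<in> I \<Longrightarrow> norm (z i) < 1" and v: "\<And>i. i \<in> I \<Longrightarrow> norm (v i) < 1"
    and zv: "\<And>i. i \<in> I \<Longrightarrow> cmod (1 - cinner (z i) (v i)) \<le> M * (1 - (norm (z i))\<^sup>2)"
  shows "rkhs.nrm ip (rkhs.kcomb (ball 0 1) da_kernel I m z)
    \<le> 2 * da_const M * rkhs.nrm ip (rkhs.kcomb (ball 0 1) da_kernel I m v)"
proof -
  interpret rkhs "ball 0 1" da_kernel H ip by (fact rk)
  let ?Z = "kcomb I m z" and ?V = "kcomb I m v"
  let ?S = "\<lambda>p q. \<Sum>j\<in>I. \<Sum>i\<in>I. m j * m i * Re (da_kernel (q j) (p i))"
  have b: "\<And>i. i \<in> I \<Longrightarrow> z i \<in> ball 0 1" "\<And>i. i \<in> I \<Longrightarrow> v i \<in> ball 0 1"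
    using z v by auto
  have mem: "?Z \<in> H" "?V \<in> H"
    using I b by (auto intro: kcomb_mem)
  have "(nrm ?Z)\<^sup>2 = ?S z z"
    using I b mem by (simp add: nrm_power2 Re_ip_kcomb_kcomb)
  also have "\<dots> \<le> (\<Sum>j\<in>I. \<Sum>i\<in>I. m j * m i *
      (da_const M * (Re (da_kernel (z j) (v i)) + Re (da_kernel (v j) (z i)))))"
    by (intro sum_mono mult_left_mono Re_da_kernel_le_sum mult_nonneg_nonneg) (use I M z v zv in auto)
  also have "\<dots> = da_const M * (?S v z + ?S z v)"
    by (simp add: sum_distrib_left sum.distrib distrib_left mult_ac)
  also have "?S v z + ?S z v = Re (ip ?V ?Z) + Re (ip ?Z ?V)"
    using I b by (simp add: Re_ip_kcomb_kcomb)
  also have "da_const M * \<dots> \<le> da_const M * (nrm ?V * nrm ?Z + nrm ?Z * nrm ?V)"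
    using mem M by (intro mult_left_mono add_mono Re_ip_le da_const_nonneg)
  finally have "nrm ?Z * nrm ?Z \<le> (2 * da_const M * nrm ?V) * nrm ?Z"
    by (simp add: power2_eq_square mult_ac)
  then show ?thesis
    using nrm_nonneg[OF mem(1)] nrm_nonneg[OF mem(2)] da_const_nonneg[OF M]
    by (cases "nrm ?Z = 0") (auto simp: mult_le_cancel_right)
qed

section \<open>Finite partitions and lower sums of the energy integral\<close>

text \<open>Each inserted set loses what the earlier ones cover. The cells keep the indices of the
  cover, so every cell keeps its centre.\<close>

lemma finite_measurable_disjointed:
  assumes "finite X" "\<And>x. x \<in> X \<Longrightarrow> B x \<in> sets M"
  shows "\<exists>C. (\<forall>x\<in>X. C x \<in> sets M \<and> C x \<subseteq> B x) \<and> disjoint_family_on C X \<and> (\<Union>x\<in>X. C x) = (\<Union>x\<in>X. B x)"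
  using assms
proof (induction X)
  case empty
  then show ?case by (auto simp: disjoint_family_on_def)
next
  case (insert a X)
  then obtain C where C: "\<forall>x\<in>X. C x \<in> sets M \<and> C x \<subseteq> B x" "disjoint_family_on C X"
    "(\<Union>x\<in>X. C x) = (\<Union>x\<in>X. B x)"
    by auto
  let ?C = "C(a := B a - (\<Union>x\<in>X. B x))"
  have eq: "?C x = C x" if "x \<in> X" for x
    using that insert.hyps by auto
  have "B a - (\<Union>x\<in>X. B x) \<in> sets M"
    using insert by (intro sets.Diff sets.finite_UN) auto
  then have "\<forall>x\<in>insert a X. ?C x \<in> sets M \<and> ?C x \<subseteq> B x"
    using C eq by auto
  moreover have "disjoint_family_on ?C (insert a X)"
  proof -
    have "C x \<subseteq> (\<Union>x\<in>X. B x)" if "x \<in> X" for x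
      using C(1) that by blast
    then have "C x \<inter> (B a - (\<Union>x\<in>X. B x)) = {}" if "x \<in> X" for x
      using that by blast
    then show ?thesis
      using C(2) insert.hyps
      by (simp add: disjoint_family_on_insert Int_commute disjoint_family_on_def)
  qed
  moreover have "(\<Union>x\<in>insert a X. ?C x) = (\<Union>x\<in>insert a X. B x)"
  proof -
    have "(\<Union>x\<in>X. ?C x) = (\<Union>x\<in>X. C x)"
      by (rule SUP_cong[OF refl eq])
    then show ?thesis using C(3) by auto
  qed
  ultimately show ?case by blast
qed

text \<open>Balls centred in \<open>G\<close> already cover the compact closure. The centres have to
  lie in \<open>G\<close> because each will supply a point of its Koranyi region.\<close>

lemma finite_net_subset:
  fixes G :: "'a :: euclidean_space set"
  assumes "bounded G" "0 < d"
  obtains X where "finite X" "X \<subseteq> G" "G \<subseteq> (\<Union>x\<in>X. ball x d)"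
proof -
  have "closure G \<subseteq> (\<Union>x\<in>G. ball x d)"
    using assms(2) by (auto simp: closure_approachable)
  moreover have "compact (closure G)"
    using assms(1) by (simp add: compact_closure)
  ultimately obtain X where X: "finite X" "X \<subseteq> G" "closure G \<subseteq> (\<Union>x\<in>X. ball x d)"
    by (metis compactE_image open_ball)
  show ?thesis
    by (rule that[OF X(1,2) order_trans[OF closure_subset X(3)]])
qed

text \<open>The left side is the iterated integral of the step function equal to
  \<open>c x y\<close> on \<open>C x \<times> C y\<close> and to 0 elsewhere. As the cells need not
  cover the space, \<open>R\<close> must be nonnegative; the bound \<open>K\<close> supplies
  integrability.\<close>

lemma (in prob_space) sum_measure_le_double_integral:
  fixes R :: "'a \<Rightarrow> 'a \<Rightarrow> real" and c :: "'i \<Rightarrow> 'i \<Rightarrow> real"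
  assumes X: "finite X" "\<And>x. x \<in> X \<Longrightarrow> C x \<in> sets M" "disjoint_family_on C X"
    and R: "(\<lambda>(z, w). R z w) \<in> borel_measurable (M \<Otimes>\<^sub>M M)"
    and bnd: "\<And>z w. z \<in> space M \<Longrightarrow> w \<in> space M \<Longrightarrow> 0 \<le> R z w \<and> R z w \<le> K"
    and c: "\<And>x y z w. x \<in> X \<Longrightarrow> y \<in> X \<Longrightarrow> z \<in> C x \<Longrightarrow> w \<in> C y \<Longrightarrow> c x y \<le> R z w"
  shows "(\<Sum>x\<in>X. \<Sum>y\<in>X. measure M (C x) * measure M (C y) * c x y) \<le> (\<integral>z. (\<integral>w. R z w \<partial>M) \<partial>M)"
proof -
  \<comment> \<open>By disjointness at most one term is nonzero; \<open>0 \<le> b\<close> handles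
    points outside all cells.\<close>
  have indle: "(\<Sum>x\<in>X. indicat_real (C x) z * g x) \<le> b"
    if "0 \<le> b" "\<And>x. x \<in> X \<Longrightarrow> z \<in> C x \<Longrightarrow> g x \<le> b" for z b and g :: "'i \<Rightarrow> real"
  proof (cases "\<exists>x\<in>X. z \<in> C x")
    case True
    then obtain x where x: "x \<in> X" "z \<in> C x" by blast
    have "(\<Sum>y\<in>X. indicat_real (C y) z * g y) = (\<Sum>y\<in>X. if y = x then g x else 0)"
      using X(3) x by (intro sum.cong) (auto simp: indicator_def disjoint_family_on_def)
    then show ?thesis using that x X by simp
  next
    case False
    then have "(\<Sum>y\<in>X. indicat_real (C y) z * g y) = 0"
      by (intro sum.neutral) (auto simp: indicator_def)
    then show ?thesis using that by simp
  qed
  have int_step: "integrable M (\<lambda>z. \<Sum>x\<in>X. indicat_real (C x) z * g x)"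
    "(\<integral>z. (\<Sum>x\<in>X. indicat_real (C x) z * g x) \<partial>M) = (\<Sum>x\<in>X. measure M (C x) * g x)" for g :: "'i \<Rightarrow> real"
  proof -
    have i: "integrable M (\<lambda>z. indicat_real (C x) z * g x)" if "x \<in> X" for x
      using X(2)[OF that] by (intro integrable_mult_left integrable_real_indicator) (auto simp: emeasure_eq_measure)
    then show "integrable M (\<lambda>z. \<Sum>x\<in>X. indicat_real (C x) z * g x)"
      by (intro Bochner_Integration.integrable_sum) 
    have "(\<integral>z. (\<Sum>x\<in>X. indicat_real (C x) z * g x) \<partial>M) = (\<Sum>x\<in>X. \<integral>z. indicat_real (C x) z * g x \<partial>M)"
      using i by (intro Bochner_Integration.integral_sum)
    also have "\<dots> = (\<Sum>x\<in>X. measure M (C x) * g x)"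
      using X(2) by (intro sum.cong refl) (simp add: sets.Int_space_eq2)
    finally show "(\<integral>z. (\<Sum>x\<in>X. indicat_real (C x) z * g x) \<partial>M) = (\<Sum>x\<in>X. measure M (C x) * g x)" .
  qed
  have intw: "integrable M (R z)" if "z \<in> space M" for z
  proof (rule integrable_const_bound[of _ K])
    show "R z \<in> borel_measurable M"
      using measurable_compose_Pair1[OF that R] by simp
  qed (use bnd that in auto)
  have inner: "(\<integral>w. R z w \<partial>M) \<le> K" "0 \<le> (\<integral>w. R z w \<partial>M)" if "z \<in> space M" for z
  proof -
    show "(\<integral>w. R z w \<partial>M) \<le> K"
      by (rule integral_le_const[OF intw[OF that]]) (use bnd that in auto)
    show "0 \<le> (\<integral>w. R z w \<partial>M)"
      by (rule Bochner_Integration.integral_nonneg) (use bnd that in auto)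
  qed
  have intz: "integrable M (\<lambda>z. \<integral>w. R z w \<partial>M)"
  proof (rule integrable_const_bound[of _ K])
    show "(\<lambda>z. \<integral>w. R z w \<partial>M) \<in> borel_measurable M"
      using borel_measurable_lebesgue_integral[OF R] by simp
  qed (use inner in auto)
  have "(\<Sum>x\<in>X. \<Sum>y\<in>X. measure M (C x) * measure M (C y) * c x y)
      = (\<Sum>x\<in>X. measure M (C x) * (\<Sum>y\<in>X. measure M (C y) * c x y))"
    by (simp add: sum_distrib_left mult_ac)
  also have "\<dots> = (\<integral>z. (\<Sum>x\<in>X. indicat_real (C x) z * (\<Sum>y\<in>X. measure M (C y) * c x y)) \<partial>M)"
    by (simp add: int_step)
  also have "\<dots> \<le> (\<integral>z. (\<integral>w. R z w \<partial>M) \<partial>M)"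
  proof (rule integral_mono[OF int_step(1) intz])
    fix z assume z: "z \<in> space M"
    show "(\<Sum>x\<in>X. indicat_real (C x) z * (\<Sum>y\<in>X. measure M (C y) * c x y)) \<le> (\<integral>w. R z w \<partial>M)"
    proof (rule indle)
      fix x assume x: "x \<in> X" "z \<in> C x"
      have "(\<Sum>y\<in>X. measure M (C y) * c x y) = (\<integral>w. (\<Sum>y\<in>X. indicat_real (C y) w * c x y) \<partial>M)"
        by (simp add: int_step)
      also have "\<dots> \<le> (\<integral>w. R z w \<partial>M)"
        by (rule integral_mono[OF int_step(1) intw[OF z]], rule indle) (use bnd z c x in auto)
      finally show "(\<Sum>y\<in>X. measure M (C y) * c x y) \<le> (\<integral>w. R z w \<partial>M)" .
    qed (use inner z in auto)
  qed
  finally show ?thesis .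
qed

section \<open>Koranyi shadows and the capacitary weak-type inequality\<close>

text \<open>For \<open>U\<close> a superlevel set of a function, this is the superlevel set of its
  Koranyi maximal function. The parameter \<open>\<delta>\<close> keeps points away from the sphere;
  \<open>\<delta> = 0\<close> gives the full regions.\<close>

definition koranyi_shadow :: "real \<Rightarrow> real \<Rightarrow> (complex ^ 'd) set \<Rightarrow> (complex ^ 'd) set"
  where "koranyi_shadow \<alpha> \<delta> U =
    {\<zeta> \<in> sphere 0 1. \<exists>z\<in>koranyi_region \<alpha> \<zeta>. \<delta> \<le> 1 - (norm z)\<^sup>2 \<and> z \<in> U}"

text \<open>For fixed \<open>z\<close> the condition on \<open>\<zeta>\<close> is a strict
  inequality between continuous functions, and the shadow is the union over \<open>z\<close> of
  these open conditions.\<close>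

lemma openin_koranyi_shadow: "openin (top_of_set (sphere 0 1)) (koranyi_shadow \<alpha> \<delta> U)"
proof -
  have "koranyi_shadow \<alpha> \<delta> U = sphere 0 1 \<inter>
      (\<Union>z\<in>{z \<in> U \<inter> ball 0 1. \<delta> \<le> 1 - (norm z)\<^sup>2}.
        {\<zeta>. cmod (1 - cinner z \<zeta>) < \<alpha> / 2 * (1 - (norm z)\<^sup>2)})"
    by (auto simp: koranyi_shadow_def koranyi_region_def)
  moreover have "open {\<zeta>. cmod (1 - cinner z \<zeta>) < \<alpha> / 2 * (1 - (norm z)\<^sup>2)}" for z :: "complex ^ 'a"
    by (intro open_Collect_less continuous_intros)
  ultimately show ?thesis
    unfolding openin_open by (intro exI conjI open_UN) auto
qed

lemma openin_sphere_measurable: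
  assumes "\<mu> \<in> sphere_prob_measures" "openin (top_of_set (sphere 0 1)) G"
  shows "G \<in> sets \<mu>"
proof -
  obtain T where "open T" and G: "G = sphere 0 1 \<inter> T"
    using assms(2) unfolding openin_open by blast
  then have "G \<in> sets (restrict_space borel (sphere 0 1))"
    unfolding sets_restrict_space by (simp add: G)
  then show ?thesis
    using assms(1) by (simp add: sphere_prob_measures_def)
qed

text \<open>Harnack in one variable and then, by symmetry, in the other. A Euclidean mesh of the
  size of the defect at radius \<open>\<rho>\<close> makes the kernels comparable.\<close>

lemma Re_da_kernel_sphere_le:
  assumes "0 \<le> \<rho>" "norm z = 1" "norm w = 1" "norm z' = 1" "norm w' = 1"
    and "norm (z - z') \<le> 1 - \<rho>\<^sup>2" "norm (w - w') \<le> 1 - \<rho>\<^sup>2" and \<rho>: "\<rho> < 1"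
  shows "Re (da_kernel (\<rho> *\<^sub>R z) (\<rho> *\<^sub>R w)) \<le> (da_const 2)\<^sup>2 * Re (da_kernel (\<rho> *\<^sub>R z') (\<rho> *\<^sub>R w'))"
proof -
  have *: "Re (da_kernel (\<rho> *\<^sub>R z) (\<rho> *\<^sub>R w)) \<le> da_const 2 * Re (da_kernel (\<rho> *\<^sub>R z) (\<rho> *\<^sub>R w'))"
    if "norm z = 1" "norm w = 1" "norm w' = 1" "norm (w - w') \<le> 1 - \<rho>\<^sup>2" for z w w' :: "complex ^ 'a"
    unfolding da_const_def
  proof (rule Re_da_kernel_Harnack)
    \<comment> \<open>One unit of \<open>M = 2\<close> is the defect itself, the other the
      displacement \<open>w - w'\<close>.\<close>
    have "1 - cinner (\<rho> *\<^sub>R w) (\<rho> *\<^sub>R w') = of_real (1 - \<rho>\<^sup>2) + of_real (\<rho>\<^sup>2) * cinner w (w - w')"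
      using that by (simp add: cinner_scaleR_left cinner_scaleR_right cinner_diff_right cinner_self
          algebra_simps power2_eq_square)
    then have "cmod (1 - cinner (\<rho> *\<^sub>R w) (\<rho> *\<^sub>R w')) \<le> cmod (of_real (1 - \<rho>\<^sup>2)) + cmod (of_real (\<rho>\<^sup>2) * cinner w (w - w'))"
      by (metis norm_triangle_ineq)
    also have "\<dots> \<le> (1 - \<rho>\<^sup>2) + 1 * (1 - \<rho>\<^sup>2)"
    proof (rule add_mono)
      show "cmod (of_real (1 - \<rho>\<^sup>2)) \<le> 1 - \<rho>\<^sup>2"
        using assms(1) \<rho> by (simp only: norm_of_real) (simp add: power_le_one)
      have "cmod (of_real (\<rho>\<^sup>2) * cinner w (w - w')) = \<rho>\<^sup>2 * cmod (cinner w (w - w'))"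
        by (simp add: norm_mult norm_power)
      also have "\<dots> \<le> 1 * norm (w - w')"
        using norm_cinner_le[of w "w - w'"] that assms(1) \<rho> by (intro mult_mono) (auto simp: power_le_one)
      finally show "cmod (of_real (\<rho>\<^sup>2) * cinner w (w - w')) \<le> 1 * (1 - \<rho>\<^sup>2)"
        using that by simp
    qed
    finally show "cmod (1 - cinner (\<rho> *\<^sub>R w) (\<rho> *\<^sub>R w')) \<le> 2 * (1 - (norm (\<rho> *\<^sub>R z))\<^sup>2)"
      using that assms(1) by simp
  qed (use that assms(1) \<rho> in auto)
  have "Re (da_kernel (\<rho> *\<^sub>R z) (\<rho> *\<^sub>R w)) \<le> da_const 2 * Re (da_kernel (\<rho> *\<^sub>R w') (\<rho> *\<^sub>R z))"
    using *[of z w w'] assms by (simp add: Re_da_kernel_commute[of "\<rho> *\<^sub>R z" "\<rho> *\<^sub>R w'"])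
  also have "\<dots> \<le> da_const 2 * (da_const 2 * Re (da_kernel (\<rho> *\<^sub>R w') (\<rho> *\<^sub>R z')))"
    using assms by (intro mult_left_mono * da_const_nonneg) auto
  finally show ?thesis
    by (simp add: power2_eq_square Re_da_kernel_commute[of "\<rho> *\<^sub>R z'" "\<rho> *\<^sub>R w'"])
qed

lemma Re_da_kernel_measurable:
  assumes "\<mu> \<in> sphere_prob_measures"
  shows "(\<lambda>(z, w). Re (da_kernel (\<rho> *\<^sub>R z) (\<rho> *\<^sub>R w))) \<in> borel_measurable (\<mu> \<Otimes>\<^sub>M \<mu>)"
proof -
  have id: "(\<lambda>x. x) \<in> \<mu> \<rightarrow>\<^sub>M borel"
  proof -
    have "sets \<mu> = sets (restrict_space borel (sphere 0 1))"
      using assms by (simp add: sphere_prob_measures_def)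
    moreover have "(\<lambda>x. x) \<in> restrict_space borel (sphere 0 1) \<rightarrow>\<^sub>M borel"
      by (rule measurable_restrict_space1) simp
    ultimately show ?thesis
      using measurable_cong_sets[OF _ refl] by blast
  qed
  have [measurable]: "(\<lambda>p. fst p $ i) \<in> borel_measurable (\<mu> \<Otimes>\<^sub>M \<mu>)"
    "(\<lambda>p. snd p $ i) \<in> borel_measurable (\<mu> \<Otimes>\<^sub>M \<mu>)" for i
  proof -
    have c: "(\<lambda>x::complex ^ 'a. x $ i) \<in> borel_measurable borel"
      by (rule borel_measurable_continuous_onI, rule continuous_on_component, rule continuous_on_id)
    then have "(\<lambda>x. x $ i) \<in> borel_measurable \<mu>"
      by (rule measurable_compose[OF id])
    then show "(\<lambda>p. fst p $ i) \<in> borel_measurable (\<mu> \<Otimes>\<^sub>M \<mu>)" "(\<lambda>p. snd p $ i) \<in> borel_measurable (\<mu> \<Otimes>\<^sub>M \<mu>)"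
      by (rule measurable_compose[OF measurable_fst], rule measurable_compose[OF measurable_snd])
  qed
  have [measurable]: "cnj \<in> borel_measurable borel"
    by (rule borel_measurable_continuous_onI, rule continuous_on_cnj, rule continuous_on_id)
  show ?thesis
    unfolding da_kernel_def cinner_def vector_scaleR_component case_prod_beta by measurable
qed

text \<open>The factor 16 combines 2 from absorption, 2 from halving the threshold and 4 from the
  number of rotations.\<close>

definition weak_const :: "real \<Rightarrow> real"
  where "weak_const \<alpha> = 16 * da_const (\<alpha> / 2 + 1) * da_const 2"

text \<open>The duality argument at bounded depth, where one mesh and one radius serve all cells.
  The number \<open>\<epsilon>\<close> takes the place of the norm of \<open>h\<close>: it controls
  only the pairings with kernel sums.\<close>

lemma weak_type_Re_truncated:
  fixes \<mu> :: "(complex ^ 'd) measure"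
  assumes rk: "rkhs (ball 0 1) da_kernel H ip" and h: "h \<in> H"
    and \<mu>: "\<mu> \<in> sphere_prob_measures"
    and \<alpha>: "0 \<le> \<alpha>" and \<delta>: "0 < \<delta>" "\<delta> \<le> 1" and e: "0 \<le> e" "0 \<le> \<epsilon>"
    and energy: "\<And>\<rho>. 0 \<le> \<rho> \<Longrightarrow> \<rho> < 1 \<Longrightarrow>
      (\<integral>z. (\<integral>w. Re (da_kernel (\<rho> *\<^sub>R z) (\<rho> *\<^sub>R w)) \<partial>\<mu>) \<partial>\<mu>) \<le> e\<^sup>2"
    and small: "\<And>(I :: (complex ^ 'd) set) m p. finite I \<Longrightarrow> p ` I \<subseteq> ball 0 1 \<Longrightarrow>
      Re (ip h (rkhs.kcomb (ball 0 1) da_kernel I m p))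
        \<le> \<epsilon> * rkhs.nrm ip (rkhs.kcomb (ball 0 1) da_kernel I m p)"
  shows "t * measure \<mu> (koranyi_shadow \<alpha> \<delta> {z. t < Re (h z)})
    \<le> \<epsilon> * (2 * da_const (\<alpha> / 2 + 1) * (da_const 2 * e))"
proof -
  interpret rkhs "ball 0 1" da_kernel H ip by (fact rk)
  interpret prob_space \<mu> using \<mu> by (simp add: sphere_prob_measures_def)
  define G where "G = koranyi_shadow \<alpha> \<delta> {z. t < Re (h z)}"
  \<comment> \<open>At this radius the defect equals the mesh \<open>\<delta>\<close>, and no chosen
    point \<open>z x\<close> lies farther out; replacing \<open>x\<close> by
    \<open>\<rho> *\<^sub>R x\<close> therefore costs at most the defect of
    \<open>z x\<close>.\<close>
  define \<rho> where "\<rho> = sqrt (1 - \<delta>)"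
  have \<rho>: "0 \<le> \<rho>" "\<rho> < 1" "1 - \<rho>\<^sup>2 = \<delta>"
    using \<delta> by (auto simp: \<rho>_def)
  have space: "space \<mu> = sphere 0 1"
    using \<mu> sets_eq_imp_space_eq[of \<mu>] by (fastforce simp: sphere_prob_measures_def space_restrict_space)
  have Gs: "G \<subseteq> sphere 0 1"
    by (auto simp: G_def koranyi_shadow_def)
  obtain X where X: "finite X" "X \<subseteq> G" "G \<subseteq> (\<Union>x\<in>X. ball x \<delta>)"
    using finite_net_subset[of G \<delta>] \<delta> bounded_subset[OF _ Gs] by auto
  have "ball x \<delta> \<inter> G \<in> sets \<mu>" for x
  proof -
    have "openin (top_of_set (sphere 0 1)) (ball x \<delta> \<inter> G)"
      unfolding G_def by (intro openin_Int_open[of _ _ "ball x \<delta>", folded Int_commute[of "ball x \<delta>"]] openin_koranyi_shadow open_ball)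
    then show ?thesis by (rule openin_sphere_measurable[OF \<mu>])
  qed
  then obtain C where C: "\<And>x. x \<in> X \<Longrightarrow> C x \<in> sets \<mu>" "\<And>x. x \<in> X \<Longrightarrow> C x \<subseteq> ball x \<delta> \<inter> G"
      "disjoint_family_on C X" and CU: "(\<Union>x\<in>X. C x) = (\<Union>x\<in>X. ball x \<delta> \<inter> G)"
    using finite_measurable_disjointed[OF X(1), of "\<lambda>x. ball x \<delta> \<inter> G" \<mu>] by metis
  have CG: "(\<Union>x\<in>X. C x) = G"
    unfolding CU using X by auto
  define m where "m x = measure \<mu> (C x)" for x
  \<comment> \<open>One point is chosen per net point rather than per boundary point, which avoids
    measurable selection.\<close>
  have "\<forall>x\<in>X. \<exists>z. z \<in> koranyi_region \<alpha> x \<and> \<delta> \<le> 1 - (norm z)\<^sup>2 \<and> t < Re (h z)"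
    using X(2) by (auto simp: G_def koranyi_shadow_def)
  then obtain z where z: "\<And>x. x \<in> X \<Longrightarrow> z x \<in> koranyi_region \<alpha> x"
    "\<And>x. x \<in> X \<Longrightarrow> \<delta> \<le> 1 - (norm (z x))\<^sup>2" "\<And>x. x \<in> X \<Longrightarrow> t < Re (h (z x))"
    by metis
  have nz: "norm (z x) < 1" if "x \<in> X" for x
    using z(1)[OF that] by (simp add: koranyi_region_def)
  have nX: "norm x = 1" if "x \<in> X" for x
    using that X Gs by auto
  let ?Z = "kcomb X m z" and ?V = "kcomb X m (\<lambda>x. \<rho> *\<^sub>R x)"
  have "nrm ?Z \<le> 2 * da_const (\<alpha> / 2 + 1) * nrm ?V"
  proof (rule nrm_kcomb_le[OF rk X(1)])
    fix x assume x: "x \<in> X"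
    show "cmod (1 - cinner (z x) (\<rho> *\<^sub>R x)) \<le> (\<alpha> / 2 + 1) * (1 - (norm (z x))\<^sup>2)"
    proof -
      have "1 - cinner (z x) (\<rho> *\<^sub>R x) = (1 - cinner (z x) x) + of_real (1 - \<rho>) * cinner (z x) x"
        by (simp add: cinner_scaleR_right algebra_simps)
      then have "cmod (1 - cinner (z x) (\<rho> *\<^sub>R x)) \<le> cmod (1 - cinner (z x) x) + cmod (of_real (1 - \<rho>) * cinner (z x) x)"
        by (metis norm_triangle_ineq)
      also have "cmod (of_real (1 - \<rho>) * cinner (z x) x) = (1 - \<rho>) * cmod (cinner (z x) x)"
        using \<rho> by (simp only: norm_mult norm_of_real)
      also have "\<dots> \<le> (1 - \<rho>) * 1"
        using norm_cinner_le[of "z x" x] nX[OF x] nz[OF x] \<rho> by (intro mult_left_mono) auto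
      also have "\<dots> \<le> 1 - \<rho>\<^sup>2"
        using \<rho>(1,2) by (simp add: power2_eq_square mult_left_le)
      also have "\<dots> \<le> 1 - (norm (z x))\<^sup>2"
        using z(2)[OF x] \<rho>(3) by simp
      also have "cmod (1 - cinner (z x) x) \<le> \<alpha> / 2 * (1 - (norm (z x))\<^sup>2)"
        using z(1)[OF x] by (simp add: koranyi_region_def)
      finally show ?thesis by (simp add: algebra_simps)
    qed
  qed (use \<alpha> nz nX \<rho> in \<open>auto simp: m_def\<close>)
  moreover have "nrm ?V \<le> da_const 2 * e"
  proof (rule power2_le_imp_le)
    let ?R = "\<lambda>z w. Re (da_kernel (\<rho> *\<^sub>R z) (\<rho> *\<^sub>R w))"
    have b: "\<And>x. x \<in> X \<Longrightarrow> \<rho> *\<^sub>R x \<in> ball 0 1"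
      using nX \<rho> by simp
    have "(nrm ?V)\<^sup>2 = (\<Sum>x\<in>X. \<Sum>y\<in>X. m x * m y * ?R x y)"
      using X b by (simp add: nrm_power2 Re_ip_kcomb_kcomb kcomb_mem)
    \<comment> \<open>Dividing by the two-variable Harnack constant puts the step function below the
      kernel.\<close>
    also have "\<dots> = (\<Sum>x\<in>X. \<Sum>y\<in>X. measure \<mu> (C x) * measure \<mu> (C y) * (?R x y / (da_const 2)\<^sup>2)) * (da_const 2)\<^sup>2"
      by (simp add: m_def sum_distrib_right da_const_def)
    also have "\<dots> \<le> (\<integral>z. (\<integral>w. ?R z w \<partial>\<mu>) \<partial>\<mu>) * (da_const 2)\<^sup>2"
    proof (rule mult_right_mono)
      show "(\<Sum>x\<in>X. \<Sum>y\<in>X. measure \<mu> (C x) * measure \<mu> (C y) * (?R x y / (da_const 2)\<^sup>2))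
        \<le> (\<integral>z. (\<integral>w. ?R z w \<partial>\<mu>) \<partial>\<mu>)"
      proof (rule sum_measure_le_double_integral[OF X(1) C(1,3) Re_da_kernel_measurable[OF \<mu>]])
        fix z w assume "z \<in> space \<mu>" "w \<in> space \<mu>"
        then have zw: "norm z = 1" "norm w = 1" by (auto simp: space)
        have "cmod (cinner (\<rho> *\<^sub>R z) (\<rho> *\<^sub>R w)) \<le> \<rho>\<^sup>2"
          using norm_cinner_le[of "\<rho> *\<^sub>R z" "\<rho> *\<^sub>R w"] zw \<rho> by (simp add: power2_eq_square)
        then have "\<delta> \<le> cmod (1 - cinner (\<rho> *\<^sub>R z) (\<rho> *\<^sub>R w))"
          using norm_triangle_ineq2[of 1 "cinner (\<rho> *\<^sub>R z) (\<rho> *\<^sub>R w)"] \<rho>(3) by simp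
        then have "cmod (da_kernel (\<rho> *\<^sub>R z) (\<rho> *\<^sub>R w)) \<le> 1 / \<delta>"
          using \<delta> by (simp add: da_kernel_def norm_divide frac_le)
        then show "0 \<le> ?R z w \<and> ?R z w \<le> 1 / \<delta>"
          using complex_Re_le_cmod order_trans zw \<rho> by (auto intro!: Re_da_kernel_nonneg)
      next
        fix x y z w assume xy: "x \<in> X" "y \<in> X" "z \<in> C x" "w \<in> C y"
        then have "z \<in> ball x \<delta> \<inter> G" "w \<in> ball y \<delta> \<inter> G"
          using C(2)[OF xy(1)] C(2)[OF xy(2)] xy(3,4) by blast+
        then have "norm z = 1" "norm w = 1" "norm (x - z) \<le> \<delta>" "norm (y - w) \<le> \<delta>"
          using Gs by (auto simp: dist_norm)
        then have "?R x y \<le> (da_const 2)\<^sup>2 * ?R z w"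
          using \<rho> nX xy by (intro Re_da_kernel_sphere_le) auto
        then show "?R x y / (da_const 2)\<^sup>2 \<le> ?R z w"
          by (simp add: da_const_def)
      qed
    qed simp
    also have "\<dots> \<le> e\<^sup>2 * (da_const 2)\<^sup>2"
      by (intro mult_right_mono energy \<rho>) simp
    finally show "(nrm ?V)\<^sup>2 \<le> (da_const 2 * e)\<^sup>2"
      by (simp add: power_mult_distrib mult.commute)
  qed (use e da_const_nonneg in auto)
  then have "2 * da_const (\<alpha> / 2 + 1) * nrm ?V \<le> 2 * da_const (\<alpha> / 2 + 1) * (da_const 2 * e)"
    using \<alpha> da_const_nonneg[of "\<alpha> / 2 + 1"] by (intro mult_left_mono) auto
  ultimately have "nrm ?Z \<le> 2 * da_const (\<alpha> / 2 + 1) * (da_const 2 * e)"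
    by linarith
  then have Z: "\<epsilon> * nrm ?Z \<le> \<epsilon> * (2 * da_const (\<alpha> / 2 + 1) * (da_const 2 * e))"
    using e by (intro mult_left_mono)
  have "t * measure \<mu> G = (\<Sum>x\<in>X. m x * t)"
    unfolding m_def CG[symmetric] using X C
    by (subst finite_measure_finite_Union) (auto simp: sum_distrib_left mult.commute)
  also have "\<dots> \<le> (\<Sum>x\<in>X. m x * Re (h (z x)))"
    using z(3) by (intro sum_mono mult_left_mono) (auto simp: m_def less_imp_le)
  also have "\<dots> = Re (ip h ?Z)"
    using X h nz by (simp add: ip_kcomb)
  also have "\<dots> \<le> \<epsilon> * nrm ?Z"
    using nz X(1) by (intro small) auto
  finally show ?thesis using Z by (simp add: G_def)
qed


text \<open>The truncated bound is independent of \<open>\<delta>\<close>, so continuity of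
  \<open>\<mu>\<close> from below along \<open>\<delta> = 1 / Suc n\<close> removes the
  truncation.\<close>

lemma weak_type_Re:
  fixes \<mu> :: "(complex ^ 'd) measure"
  assumes rk: "rkhs (ball 0 1) da_kernel H ip" and h: "h \<in> H"
    and \<mu>: "\<mu> \<in> sphere_prob_measures"
    and \<alpha>: "0 \<le> \<alpha>" and e: "0 \<le> e" "0 \<le> \<epsilon>"
    and energy: "\<And>\<rho>. 0 \<le> \<rho> \<Longrightarrow> \<rho> < 1 \<Longrightarrow>
      (\<integral>z. (\<integral>w. Re (da_kernel (\<rho> *\<^sub>R z) (\<rho> *\<^sub>R w)) \<partial>\<mu>) \<partial>\<mu>) \<le> e\<^sup>2"
    and small: "\<And>(I :: (complex ^ 'd) set) m p. finite I \<Longrightarrow> p ` I \<subseteq> ball 0 1 \<Longrightarrow>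
      Re (ip h (rkhs.kcomb (ball 0 1) da_kernel I m p))
        \<le> \<epsilon> * rkhs.nrm ip (rkhs.kcomb (ball 0 1) da_kernel I m p)"
  shows "t * measure \<mu> (koranyi_shadow \<alpha> 0 {z. t < Re (h z)})
    \<le> \<epsilon> * (2 * da_const (\<alpha> / 2 + 1) * (da_const 2 * e))"
proof -
  interpret prob_space \<mu> using \<mu> by (simp add: sphere_prob_measures_def)
  let ?U = "{z. t < Re (h z)}"
  let ?G = "\<lambda>n. koranyi_shadow \<alpha> (1 / real (Suc n)) ?U"
  have "incseq ?G"
  proof (rule incseq_SucI)
    fix n
    have "1 / real (Suc (Suc n)) \<le> 1 / real (Suc n)"
      by (simp add: frac_le)
    then show "?G n \<le> ?G (Suc n)"
      unfolding koranyi_shadow_def by (smt (verit) mem_Collect_eq subsetI)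
  qed
  moreover have "range ?G \<subseteq> sets \<mu>"
    using openin_sphere_measurable[OF \<mu> openin_koranyi_shadow] by blast
  ultimately have "(\<lambda>n. measure \<mu> (?G n)) \<longlonglongrightarrow> measure \<mu> (\<Union>n. ?G n)"
    by (intro finite_Lim_measure_incseq)
  moreover have "(\<Union>n. ?G n) = koranyi_shadow \<alpha> 0 ?U"
  proof (intro equalityI subsetI)
    fix \<zeta> assume "\<zeta> \<in> (\<Union>n. ?G n)"
    then obtain n z where "\<zeta> \<in> sphere 0 1" "z \<in> koranyi_region \<alpha> \<zeta>" "z \<in> ?U"
        "1 / real (Suc n) \<le> 1 - (norm z)\<^sup>2"
      unfolding koranyi_shadow_def by blast
    moreover from this(4) have "0 \<le> 1 - (norm z)\<^sup>2"
      by (rule order_trans[rotated]) simp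
    ultimately show "\<zeta> \<in> koranyi_shadow \<alpha> 0 ?U"
      unfolding koranyi_shadow_def by blast
  next
    fix \<zeta> assume "\<zeta> \<in> koranyi_shadow \<alpha> 0 ?U"
    then obtain z where z: "\<zeta> \<in> sphere 0 1" "z \<in> koranyi_region \<alpha> \<zeta>" "z \<in> ?U"
      unfolding koranyi_shadow_def by blast
    then have "0 < 1 - (norm z)\<^sup>2"
      by (simp add: koranyi_region_def abs_square_less_1)
    then obtain n where "1 / real (Suc n) < 1 - (norm z)\<^sup>2"
      using nat_approx_posE by blast
    then have "\<zeta> \<in> ?G n"
      unfolding koranyi_shadow_def using z less_imp_le by blast
    then show "\<zeta> \<in> (\<Union>n. ?G n)" by blast
  qed
  ultimately have "(\<lambda>n. t * measure \<mu> (?G n)) \<longlonglongrightarrow> t * measure \<mu> (koranyi_shadow \<alpha> 0 ?U)"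
    by (intro tendsto_mult tendsto_const) simp
  then show ?thesis
  proof (rule LIMSEQ_le_const2)
    have "t * measure \<mu> (?G n) \<le> \<epsilon> * (2 * da_const (\<alpha> / 2 + 1) * (da_const 2 * e))" for n
      by (rule weak_type_Re_truncated[OF rk h \<mu> \<alpha> _ _ e energy small]) simp_all
    then show "\<exists>N. \<forall>n\<ge>N. t * measure \<mu> (?G n) \<le> \<epsilon> * (2 * da_const (\<alpha> / 2 + 1) * (da_const 2 * e))"
      by blast
  qed
qed

text \<open>Passes from the one-sided estimate for real parts to moduli.\<close>

lemma exists_rotation_Re_gt:
  assumes "t < cmod x"
  shows "\<exists>c\<in>{1, -1, \<i>, -\<i>}. t / 2 < Re (c * x)"
proof -
  have "cmod x \<le> \<bar>Re x\<bar> + \<bar>Im x\<bar>"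
    by (rule cmod_le)
  then have "t / 2 < \<bar>Re x\<bar> \<or> t / 2 < \<bar>Im x\<bar>"
    using assms by linarith
  then show ?thesis by (auto simp: abs_real_def split: if_splits)
qed

text \<open>The real-part bound is applied to the four rotations of \<open>h\<close>; this is why
  \<open>small\<close> speaks of unimodular multiples.\<close>

lemma weak_type:
  fixes \<mu> :: "(complex ^ 'd) measure"
  assumes rk: "rkhs (ball 0 1) da_kernel H ip" and h: "h \<in> H"
    and \<mu>: "\<mu> \<in> sphere_prob_measures"
    and \<alpha>: "0 \<le> \<alpha>" and e: "0 \<le> e" "0 \<le> \<epsilon>"
    and energy: "\<And>\<rho>. 0 \<le> \<rho> \<Longrightarrow> \<rho> < 1 \<Longrightarrow>
      (\<integral>z. (\<integral>w. Re (da_kernel (\<rho> *\<^sub>R z) (\<rho> *\<^sub>R w)) \<partial>\<mu>) \<partial>\<mu>) \<le> e\<^sup>2"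
    and small: "\<And>c (I :: (complex ^ 'd) set) m p. cmod c = 1 \<Longrightarrow> finite I \<Longrightarrow> p ` I \<subseteq> ball 0 1 \<Longrightarrow>
      Re (ip (\<lambda>x. c * h x) (rkhs.kcomb (ball 0 1) da_kernel I m p))
        \<le> \<epsilon> * rkhs.nrm ip (rkhs.kcomb (ball 0 1) da_kernel I m p)"
  shows "t * measure \<mu> (koranyi_shadow \<alpha> 0 {z. t < cmod (h z)}) \<le> weak_const \<alpha> * \<epsilon> * e"
proof (cases "t \<le> 0")
  case True
  then have "t * measure \<mu> (koranyi_shadow \<alpha> 0 {z. t < cmod (h z)}) \<le> 0"
    by (simp add: mult_nonpos_nonneg)
  also have "0 \<le> weak_const \<alpha> * \<epsilon> * e"
    using \<alpha> e by (auto simp: weak_const_def intro!: mult_nonneg_nonneg da_const_nonneg)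
  finally show ?thesis .
next
  case False
  interpret rkhs "ball 0 1" da_kernel H ip by (fact rk)
  interpret prob_space \<mu> using \<mu> by (simp add: sphere_prob_measures_def)
  let ?A = "{1, -1, \<i>, -\<i>} :: complex set"
  let ?G = "\<lambda>c. koranyi_shadow \<alpha> 0 {z. t / 2 < Re (c * h z)}"
  have meas: "koranyi_shadow \<alpha> 0 U \<in> sets \<mu>" for U
    by (rule openin_sphere_measurable[OF \<mu> openin_koranyi_shadow])
  have "koranyi_shadow \<alpha> 0 {z. t < cmod (h z)} \<subseteq> (\<Union>c\<in>?A. ?G c)"
  proof
    fix \<zeta> assume "\<zeta> \<in> koranyi_shadow \<alpha> 0 {z. t < cmod (h z)}"
    then obtain z where z: "\<zeta> \<in> sphere 0 1" "z \<in> koranyi_region \<alpha> \<zeta>" "0 \<le> 1 - (norm z)\<^sup>2" "t < cmod (h z)"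
      unfolding koranyi_shadow_def by blast
    from exists_rotation_Re_gt[OF z(4)] obtain c where "c \<in> ?A" "t / 2 < Re (c * h z)"
      by blast
    then show "\<zeta> \<in> (\<Union>c\<in>?A. ?G c)"
      unfolding koranyi_shadow_def using z by blast
  qed
  then have "measure \<mu> (koranyi_shadow \<alpha> 0 {z. t < cmod (h z)}) \<le> measure \<mu> (\<Union>c\<in>?A. ?G c)"
    using meas by (intro finite_measure_mono sets.finite_UN) auto
  also have "\<dots> \<le> (\<Sum>c\<in>?A. measure \<mu> (?G c))"
    using meas by (intro finite_measure_subadditive_finite) auto
  finally have "t * measure \<mu> (koranyi_shadow \<alpha> 0 {z. t < cmod (h z)}) \<le> t * (\<Sum>c\<in>?A. measure \<mu> (?G c))"
    using False by (intro mult_left_mono) auto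
  also have "\<dots> = (\<Sum>c\<in>?A. 2 * (t / 2 * measure \<mu> (?G c)))"
    by (simp only: sum_distrib_left) simp
  also have "\<dots> \<le> (\<Sum>c\<in>?A. 2 * (\<epsilon> * (2 * da_const (\<alpha> / 2 + 1) * (da_const 2 * e))))"
  proof (intro sum_mono mult_left_mono)
    fix c assume "c \<in> ?A"
    then have "cmod c = 1" by auto
    then show "t / 2 * measure \<mu> (?G c) \<le> \<epsilon> * (2 * da_const (\<alpha> / 2 + 1) * (da_const 2 * e))"
      by (intro weak_type_Re[OF rk scale_mem[OF h] \<mu> \<alpha> e energy small])
  qed simp
  also have "\<dots> = real (card ?A) * (2 * (\<epsilon> * (2 * da_const (\<alpha> / 2 + 1) * (da_const 2 * e))))"
    by simp
  also have "card ?A = 4"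
    by (simp add: complex_eq_iff)
  finally show ?thesis
    by (simp add: weak_const_def mult_ac)
qed

section \<open>Koranyi limits by uniform approximation\<close>

lemma koranyi_region_subset_ball: "koranyi_region \<alpha> \<zeta> \<subseteq> ball 0 1"
  by (auto simp: koranyi_region_def)

lemma koranyi_region_mono:
  assumes "\<alpha> \<le> \<beta>"
  shows "koranyi_region \<alpha> \<zeta> \<subseteq> koranyi_region \<beta> \<zeta>"
proof
  fix z assume z: "z \<in> koranyi_region \<alpha> \<zeta>"
  then have "0 \<le> 1 - (norm z)\<^sup>2"
    by (simp add: koranyi_region_def abs_square_le_1)
  then have "\<alpha> / 2 * (1 - (norm z)\<^sup>2) \<le> \<beta> / 2 * (1 - (norm z)\<^sup>2)"
    using assms by (intro mult_right_mono) auto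
  then show "z \<in> koranyi_region \<beta> \<zeta>"
    using z by (simp add: koranyi_region_def)
qed

text \<open>The radial points \<open>(1 - s) *\<^sub>R \<zeta>\<close> lie in the region because
  \<open>s < 2 * s - s\<^sup>2\<close> for \<open>0 < s < 1\<close>. Nontriviality lets inequalities
  pass to limits.\<close>

lemma at_within_koranyi_region_nontrivial:
  assumes \<zeta>: "\<zeta> \<in> sphere 0 1"
  shows "at \<zeta> within koranyi_region 2 \<zeta> \<noteq> bot"
proof -
  have "\<zeta> islimpt koranyi_region 2 \<zeta>"
    unfolding islimpt_approachable
  proof (intro allI impI)
    fix e :: real assume e: "0 < e"
    define s where "s = min e 1 / 2"
    have s: "0 < s" "s < e" "s < 1" using e by (auto simp: s_def)
    let ?z = "(1 - s) *\<^sub>R \<zeta>"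
    have n: "norm ?z = 1 - s" using \<zeta> s by simp
    have "1 - cinner ?z \<zeta> = of_real s"
      using \<zeta> by (simp add: cinner_scaleR_left cinner_self)
    moreover have "s < 1 - (1 - s)\<^sup>2"
      using mult_strict_left_mono[OF s(3,1)] by (simp add: power2_eq_square algebra_simps)
    ultimately have "?z \<in> koranyi_region 2 \<zeta>"
      unfolding koranyi_region_def mem_Collect_eq n using n s by (simp del: norm_scaleR)
    moreover have "dist ?z \<zeta> = s"
    proof -
      have "?z - \<zeta> = (- s) *\<^sub>R \<zeta>" by (simp add: scaleR_diff_left)
      then show ?thesis using \<zeta> s by (simp add: dist_norm)
    qed
    ultimately show "\<exists>z\<in>koranyi_region 2 \<zeta>. z \<noteq> \<zeta> \<and> dist z \<zeta> < e"
      using s by (intro bexI[of _ ?z]) auto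
  qed
  then show ?thesis by (simp add: trivial_limit_within)
qed

text \<open>An interchange of limits. As the aperture \<open>n + 2\<close> grows, every fixed region
  is eventually covered, so \<open>g\<close> converges to \<open>f\<close> uniformly on it.\<close>

lemma has_koranyi_limit_approx:
  assumes \<zeta>: "\<zeta> \<in> sphere 0 1" and cont: "continuous_on (ball 0 1) f"
    and g: "\<And>n. \<exists>l. (g n \<longlongrightarrow> l) (at \<zeta> within ball 0 1)"
    and t: "t \<longlonglongrightarrow> 0"
    and bnd: "\<And>n z. N \<le> n \<Longrightarrow> z \<in> koranyi_region (real n + 2) \<zeta> \<Longrightarrow> cmod (f z - g n z) \<le> t n"
  shows "\<exists>l. has_koranyi_limit f l \<zeta>"
proof -
  obtain L where L: "\<And>n. (g n \<longlongrightarrow> L n) (at \<zeta> within ball 0 1)"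
    using g by metis
  have Lk: "(g n \<longlongrightarrow> L n) (at \<zeta> within koranyi_region \<alpha> \<zeta>)" for n \<alpha>
    by (rule tendsto_within_subset[OF L koranyi_region_subset_ball])
  \<comment> \<open>All approximants are compared on the region of aperture 2, which every region of
    aperture \<open>n + 2\<close> contains.\<close>
  have dL: "dist (L m) (L n) \<le> t m + t n" if mn: "N \<le> m" "N \<le> n" for m n
  proof (rule tendsto_upperbound)
    show "((\<lambda>z. dist (g m z) (g n z)) \<longlongrightarrow> dist (L m) (L n)) (at \<zeta> within koranyi_region 2 \<zeta>)"
      by (intro tendsto_dist Lk)
    have "dist (g m z) (g n z) \<le> t m + t n" if "z \<in> koranyi_region 2 \<zeta>" for z
    proof -
      have "z \<in> koranyi_region (real m + 2) \<zeta>" "z \<in> koranyi_region (real n + 2) \<zeta>"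
        using that koranyi_region_mono[of 2 "real m + 2" \<zeta>] koranyi_region_mono[of 2 "real n + 2" \<zeta>] by auto
      then have "cmod (f z - g m z) \<le> t m" "cmod (f z - g n z) \<le> t n"
        using mn bnd by auto
      then show ?thesis
        using dist_triangle2[of "g m z" "g n z" "f z"] by (simp add: dist_norm norm_minus_commute)
    qed
    then show "\<forall>\<^sub>F z in at \<zeta> within koranyi_region 2 \<zeta>. dist (g m z) (g n z) \<le> t m + t n"
      by (simp add: eventually_at_filter)
  qed (rule at_within_koranyi_region_nontrivial[OF \<zeta>])
  have "Cauchy L"
  proof (rule metric_CauchyI)
    fix e :: real assume "0 < e"
    then have "\<forall>\<^sub>F n in sequentially. t n < e / 2"
      using order_tendstoD(2)[OF t, of "e / 2"] by simp
    then obtain M where M: "\<And>n. M \<le> n \<Longrightarrow> t n < e / 2"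
      by (auto simp: eventually_sequentially)
    have "dist (L m) (L n) < e" if "max M N \<le> m" "max M N \<le> n" for m n
      using dL[of m n] M[of m] M[of n] that by simp
    then show "\<exists>M. \<forall>m\<ge>M. \<forall>n\<ge>M. dist (L m) (L n) < e" by blast
  qed
  then obtain l where l: "L \<longlonglongrightarrow> l"
    using Cauchy_convergent convergent_def by blast
  have "(f \<longlongrightarrow> l) (at \<zeta> within koranyi_region \<alpha> \<zeta>)" for \<alpha>
  proof (rule swap_uniform_limit)
    show "\<forall>\<^sub>F n in sequentially. (g n \<longlongrightarrow> L n) (at \<zeta> within koranyi_region \<alpha> \<zeta>)"
      using Lk by simp
    show "uniform_limit (koranyi_region \<alpha> \<zeta>) g f sequentially"
    proof (rule uniform_limitI)
      fix e :: real assume "0 < e"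
      then have "\<forall>\<^sub>F n in sequentially. t n < e"
        using order_tendstoD(2)[OF t] by simp
      moreover have "\<forall>\<^sub>F n in sequentially. N \<le> n"
        by (rule eventually_ge_at_top)
      moreover have "\<forall>\<^sub>F n in sequentially. \<alpha> \<le> real n"
        using filterlim_real_sequentially by (simp add: filterlim_at_top)
      ultimately show "\<forall>\<^sub>F n in sequentially. \<forall>z\<in>koranyi_region \<alpha> \<zeta>. dist (g n z) (f z) < e"
      proof eventually_elim
        case (elim n)
        show ?case
        proof
          fix z assume "z \<in> koranyi_region \<alpha> \<zeta>"
          then have "z \<in> koranyi_region (real n + 2) \<zeta>"
            using koranyi_region_mono[of \<alpha> "real n + 2" \<zeta>] elim by auto
          then show "dist (g n z) (f z) < e"
            using bnd[of n z] elim by (simp add: dist_norm norm_minus_commute)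
        qed
      qed
    qed
  qed (use l in auto)
  then show ?thesis
    using cont by (auto simp: has_koranyi_limit_def)
qed

section \<open>Approximation by functions with boundary limits\<close>

lemma kernel_boundary_limit:
  assumes "w \<in> ball 0 1" "\<zeta> \<in> sphere 0 1"
  shows "((\<lambda>z. if z \<in> ball 0 1 then da_kernel z w else 0) \<longlongrightarrow> da_kernel \<zeta> w) (at \<zeta> within ball 0 1)"
proof -
  have "cmod (cinner \<zeta> w) < 1"
    using norm_cinner_le[of \<zeta> w] assms by simp
  then have nz: "1 - cinner \<zeta> w \<noteq> 0" by auto
  have "continuous_on UNIV (\<lambda>z. cinner z w)"
    by (intro continuous_intros)
  then have "((\<lambda>z. cinner z w) \<longlongrightarrow> cinner \<zeta> w) (at \<zeta> within ball 0 1)"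
    by (metis UNIV_I continuous_on_def subset_UNIV tendsto_within_subset)
  then have lim: "((\<lambda>z. da_kernel z w) \<longlongrightarrow> da_kernel \<zeta> w) (at \<zeta> within ball 0 1)"
    unfolding da_kernel_def by (intro tendsto_divide tendsto_diff tendsto_const nz)
  have "\<forall>\<^sub>F z in at \<zeta> within ball 0 1. da_kernel z w = (if z \<in> ball 0 1 then da_kernel z w else 0)"
    by (auto simp: eventually_at_filter)
  then show ?thesis
    by (rule Lim_transform_eventually[OF lim])
qed

text \<open>The error \<open>f - g\<close> is only made nearly orthogonal to kernel sums, not small
  in norm; such pairings are all that \<open>weak_type\<close> asks for.\<close>

lemma weak_approximation:
  fixes f :: "complex ^ 'd \<Rightarrow> complex"
  assumes rk: "rkhs (ball 0 1) da_kernel H ip" and f: "f \<in> H" and e: "0 < \<epsilon>"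
  shows "\<exists>g\<in>H. (\<forall>\<zeta>\<in>sphere 0 1. \<exists>l. (g \<longlongrightarrow> l) (at \<zeta> within ball 0 1)) \<and>
    (\<forall>c (I :: (complex ^ 'd) set) m p. cmod c = 1 \<longrightarrow> finite I \<longrightarrow> p ` I \<subseteq> ball 0 1 \<longrightarrow>
      Re (ip (\<lambda>x. c * (f x - g x)) (rkhs.kcomb (ball 0 1) da_kernel I m p))
        \<le> \<epsilon> * rkhs.nrm ip (rkhs.kcomb (ball 0 1) da_kernel I m p))"
proof -
  interpret rkhs "ball 0 1" da_kernel H ip by (fact rk)
  \<comment> \<open>All members of \<open>H\<close> with boundary limits, rather than just the span
    of the kernels: closure under addition and scaling is then immediate.\<close>
  define S where "S = {g \<in> H. \<forall>\<zeta>\<in>sphere 0 1. \<exists>l. (g \<longlongrightarrow> l) (at \<zeta> within ball 0 1)}"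
  have SH: "S \<subseteq> H" by (auto simp: S_def)
  have zero: "(\<lambda>x. 0) \<in> S"
    by (auto simp: S_def zero_mem intro: tendsto_const)
  have add: "(\<lambda>x. g x + h x) \<in> S" if "g \<in> S" "h \<in> S" for g h
    using that add_mem tendsto_add unfolding S_def by blast
  have scale: "(\<lambda>x. c * g x) \<in> S" if "g \<in> S" for c g
    using that scale_mem tendsto_mult_left unfolding S_def by blast
  have kfunS: "kfun w \<in> S" if "w \<in> ball 0 1" for w
    using that kfun_mem[OF that] kernel_boundary_limit[OF that] unfolding S_def kfun_def by blast
  obtain g where g: "g \<in> S" and orth: "\<And>s. s \<in> S \<Longrightarrow> Re (ip (\<lambda>x. f x - g x) s) \<le> \<epsilon> * nrm s"
    using almost_orthogonal[OF SH zero add scale f e] by blast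
  have fg: "(\<lambda>x. f x - g x) \<in> H"
    using f g SH by (auto intro: diff_mem)
  have "Re (ip (\<lambda>x. c * (f x - g x)) (kcomb I m p)) \<le> \<epsilon> * nrm (kcomb I m p)"
    if "cmod c = 1" "finite I" "p ` I \<subseteq> ball 0 1" for c and I :: "(complex ^ 'd) set" and m p
  proof -
    let ?k = "kcomb I m p"
    have k: "?k \<in> S"
      by (rule kcomb_mem_subspace[OF that(2) kfunS zero add scale]) (use that in auto)
    then have kH: "?k \<in> H" using SH by blast
    \<comment> \<open>The unimodular factor moves to the kernel sum, which stays in \<open>S\<close>
      with the same norm.\<close>
    have "ip (\<lambda>x. c * (f x - g x)) ?k = ip (\<lambda>x. f x - g x) (\<lambda>x. cnj c * ?k x)"
      using fg kH by (simp add: ip_scale_left ip_scale_right)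
    then show ?thesis
      using orth[OF scale[OF k, of "cnj c"]] nrm_scale[OF kH, of "cnj c"] that(1) by simp
  qed
  then show ?thesis using g unfolding S_def by blast
qed

section \<open>From uniform bounds on measures to capacity\<close>

text \<open>A probability measure carried by a compact subset of \<open>U\<close> gives
  \<open>U\<close> mass 1, so the bound with \<open>e\<close> the root of its energy reads
  \<open>1 \<le> q * e\<close>. Infinite energy contributes
  \<open>1 / \<infinity> = 0\<close>.\<close>

lemma inner_cap_le:
  fixes U :: "(complex ^ 'd) set"
  assumes U: "openin (top_of_set (sphere 0 1)) U" and q: "0 \<le> q"
    and bnd: "\<And>\<mu> e. \<mu> \<in> sphere_prob_measures \<Longrightarrow> 0 \<le> e \<Longrightarrow>
      (\<And>\<rho>. 0 \<le> \<rho> \<Longrightarrow> \<rho> < 1 \<Longrightarrow>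
        (\<integral>z. (\<integral>w. Re (da_kernel (\<rho> *\<^sub>R z) (\<rho> *\<^sub>R w)) \<partial>\<mu>) \<partial>\<mu>) \<le> e\<^sup>2) \<Longrightarrow>
      measure \<mu> U \<le> q * e"
  shows "inner_cap U \<le> ennreal (q\<^sup>2)"
  unfolding inner_cap_def cap_compact_def
proof (intro SUP_least)
  fix F :: "(complex ^ 'd) set" and \<mu>
  assume "F \<in> {F. compact F \<and> F \<subseteq> U}" "\<mu> \<in> {\<mu> \<in> sphere_prob_measures. emeasure \<mu> (sphere 0 1 - F) = 0}"
  then have F: "compact F" "F \<subseteq> U" and \<mu>: "\<mu> \<in> sphere_prob_measures" and null: "emeasure \<mu> (sphere 0 1 - F) = 0"
    by auto
  interpret prob_space \<mu> using \<mu> by (simp add: sphere_prob_measures_def)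
  have space: "space \<mu> = sphere 0 1"
    using \<mu> sets_eq_imp_space_eq[of \<mu>] by (fastforce simp: sphere_prob_measures_def space_restrict_space)
  have "openin (top_of_set (sphere 0 1)) (sphere 0 1 \<inter> - F)"
    using F by (intro openin_open_Int) (simp add: compact_imp_closed open_Compl)
  then have Fm: "sphere 0 1 - F \<in> sets \<mu>"
    using openin_sphere_measurable[OF \<mu>] by (simp add: Diff_eq)
  have Um: "U \<in> sets \<mu>"
    by (rule openin_sphere_measurable[OF \<mu> U])
  have "measure \<mu> (space \<mu> - U) \<le> measure \<mu> (sphere 0 1 - F)"
    using F Fm space by (intro finite_measure_mono) auto
  then have "measure \<mu> (space \<mu> - U) \<le> 0"
    using null by (simp add: measure_def)
  then have U1: "measure \<mu> U = 1"
    using prob_compl[OF Um] prob_le_1[of U] by linarith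
  show "1 / energy \<mu> \<le> ennreal (q\<^sup>2)"
  proof (cases "energy \<mu>")
    case top
    then show ?thesis by simp
  next
    case (real r)
    have "measure \<mu> U \<le> q * sqrt r"
    proof (rule bnd[OF \<mu>])
      fix \<rho> :: real assume \<rho>: "0 \<le> \<rho>" "\<rho> < 1"
      have "ennreal (\<integral>z. (\<integral>w. Re (da_kernel (\<rho> *\<^sub>R z) (\<rho> *\<^sub>R w)) \<partial>\<mu>) \<partial>\<mu>) \<le> energy \<mu>"
        unfolding energy_def using \<rho> by (intro SUP_upper) auto
      then show "(\<integral>z. (\<integral>w. Re (da_kernel (\<rho> *\<^sub>R z) (\<rho> *\<^sub>R w)) \<partial>\<mu>) \<partial>\<mu>) \<le> (sqrt r)\<^sup>2"
        using real by (simp add: ennreal_le_iff)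
    qed (use real in auto)
    then have 1: "1 \<le> q * sqrt r" using U1 by simp
    then have "1 \<le> (q * sqrt r)\<^sup>2"
      by (rule one_le_power)
    then have *: "1 \<le> q\<^sup>2 * r" using real by (simp add: power_mult_distrib)
    \<comment> \<open>The inequality itself excludes zero energy, so the reciprocal is
      finite.\<close>
    then have "r \<noteq> 0" by auto
    then have r: "0 < r" using real by simp
    have "1 / energy \<mu> = ennreal (1 / r)"
      using real r divide_ennreal[of 1 r] by simp
    also have "\<dots> \<le> ennreal (q\<^sup>2)"
      using * r by (intro ennreal_leI) (simp add: field_simps)
    finally show ?thesis .
  qed
qed

lemma holomorphic_on_vec_continuous:
  assumes "holomorphic_on_vec f S"
  shows "continuous_on S f"
proof (rule continuous_at_imp_continuous_on, rule ballI)
  fix z assume "z \<in> S"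
  then obtain L where "(f has_derivative L) (at z)"
    using assms unfolding holomorphic_on_vec_def by blast
  then show "isCont f z"
    by (rule has_derivative_continuous)
qed

section \<open>Construction of the exceptional set\<close>

theorem theorem1p1:
  fixes f :: "complex ^ 'd \<Rightarrow> complex"
  assumes "f \<in> drury_arveson"
  shows "\<exists>E. E \<in> sets borel \<and> E \<subseteq> sphere 0 1 \<and> outer_cap E = 0 \<and>
           (\<forall>\<zeta>\<in>sphere 0 1 - E. \<exists>l. has_koranyi_limit f l \<zeta>)"
proof -
  obtain H ip where rk: "rkhs (ball 0 1) da_kernel H ip" and f: "f \<in> H"
      and hol: "holomorphic_on_vec f (ball 0 1)"
    using assms by (auto simp: drury_arveson_def)
  interpret rkhs "ball 0 1" da_kernel H ip by (fact rk)
  define \<alpha> where "\<alpha> n = real n + 2" for n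
  define t where "t n = 1 / real (Suc n)" for n
  \<comment> \<open>Chosen so that the weak-type bound, divided by the threshold \<open>t n\<close>,
    is at most \<open>(1 / 2) ^ n * e\<close>. The \<open>+ 1\<close> keeps the denominator visibly
    positive.\<close>
  define \<epsilon> where "\<epsilon> n = t n * (1 / 2) ^ n / (weak_const (\<alpha> n) + 1)" for n
  have t: "0 < t n" and wc: "0 \<le> weak_const (\<alpha> n)" for n
    by (auto simp: t_def \<alpha>_def weak_const_def da_const_def)
  then have \<epsilon>: "0 < \<epsilon> n" for n
    by (simp add: \<epsilon>_def add_nonneg_pos)
  have "\<exists>g. \<forall>n. g n \<in> H \<and>
      (\<forall>\<zeta>\<in>sphere 0 1. \<exists>l. (g n \<longlongrightarrow> l) (at \<zeta> within ball 0 1)) \<and>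
      (\<forall>c (I :: (complex ^ 'd) set) m p. cmod c = 1 \<longrightarrow> finite I \<longrightarrow> p ` I \<subseteq> ball 0 1 \<longrightarrow>
        Re (ip (\<lambda>x. c * (f x - g n x)) (kcomb I m p)) \<le> \<epsilon> n * nrm (kcomb I m p))"
    by (rule choice, rule allI) (rule weak_approximation[OF rk f \<epsilon>, unfolded Bex_def])
  then obtain g where g: "\<And>n. g n \<in> H" "\<And>n \<zeta>. \<zeta> \<in> sphere 0 1 \<Longrightarrow> \<exists>l. (g n \<longlongrightarrow> l) (at \<zeta> within ball 0 1)"
    and orth: "\<And>n c (I :: (complex ^ 'd) set) m p. cmod c = 1 \<Longrightarrow> finite I \<Longrightarrow> p ` I \<subseteq> ball 0 1 \<Longrightarrow>
      Re (ip (\<lambda>x. c * (f x - g n x)) (kcomb I m p)) \<le> \<epsilon> n * nrm (kcomb I m p)"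
    by blast
  \<comment> \<open>\<open>G n\<close> collects the boundary points where the \<open>n\<close>-th
    approximation is off by more than \<open>t n\<close> somewhere in the region of aperture
    \<open>n + 2\<close>; \<open>U N\<close> is the union of a tail.\<close>
  define G where "G n = koranyi_shadow (\<alpha> n) 0 {z. t n < cmod (f z - g n z)}" for n
  define U where "U N = (\<Union>n. G (n + N))" for N
  have Uopen: "openin (top_of_set (sphere 0 1)) (U N)" for N
    unfolding U_def G_def by (intro openin_Union ballI) (auto intro: openin_koranyi_shadow)
  have measG: "measure \<mu> (G n) \<le> (1 / 2) ^ n * e"
    if \<mu>: "\<mu> \<in> sphere_prob_measures" and e: "0 \<le> e"
      and energy: "\<And>\<rho>. 0 \<le> \<rho> \<Longrightarrow> \<rho> < 1 \<Longrightarrow>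
        (\<integral>z. (\<integral>w. Re (da_kernel (\<rho> *\<^sub>R z) (\<rho> *\<^sub>R w)) \<partial>\<mu>) \<partial>\<mu>) \<le> e\<^sup>2" for \<mu> e n
  proof -
    have "t n * measure \<mu> (G n) \<le> weak_const (\<alpha> n) * \<epsilon> n * e"
      unfolding G_def
      by (rule weak_type[OF rk diff_mem[OF f g(1)] \<mu> _ e _ energy orth]) (use \<epsilon> less_imp_le in \<open>auto simp: \<alpha>_def\<close>)
    also have "weak_const (\<alpha> n) * \<epsilon> n \<le> (weak_const (\<alpha> n) + 1) * \<epsilon> n"
      using \<epsilon>[of n] by simp
    also have "\<dots> = t n * (1 / 2) ^ n"
      using wc[of n] by (simp add: \<epsilon>_def)
    finally have "t n * measure \<mu> (G n) \<le> t n * ((1 / 2) ^ n * e)"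
      using e by (simp add: mult_right_mono mult.assoc)
    then show ?thesis using t[of n] by simp
  qed
  have capU: "inner_cap (U N) \<le> ennreal ((2 * (1 / 2) ^ N)\<^sup>2)" for N
  proof (rule inner_cap_le[OF Uopen])
    fix \<mu> :: "(complex ^ 'd) measure" and e :: real
    assume \<mu>: "\<mu> \<in> sphere_prob_measures" and e: "0 \<le> e"
      and energy: "\<And>\<rho>. 0 \<le> \<rho> \<Longrightarrow> \<rho> < 1 \<Longrightarrow>
        (\<integral>z. (\<integral>w. Re (da_kernel (\<rho> *\<^sub>R z) (\<rho> *\<^sub>R w)) \<partial>\<mu>) \<partial>\<mu>) \<le> e\<^sup>2"
    interpret prob_space \<mu> using \<mu> by (simp add: sphere_prob_measures_def)
    have Gm: "G n \<in> sets \<mu>" for n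
      unfolding G_def by (rule openin_sphere_measurable[OF \<mu> openin_koranyi_shadow])
    have le: "measure \<mu> (G (n + N)) \<le> (1 / 2) ^ n * ((1 / 2) ^ N * e)" for n
      using measG[OF \<mu> e energy, of "n + N"] by (simp add: power_add mult.assoc)
    have sums: "(\<lambda>n. (1 / 2) ^ n * ((1 / 2) ^ N * e)) sums (2 * ((1 / 2) ^ N * e))"
      using sums_mult2[OF geometric_sums[of "1 / 2 :: real"]] by simp
    have summ: "summable (\<lambda>n. measure \<mu> (G (n + N)))"
      by (rule summable_comparison_test'[OF sums_summable[OF sums]]) (use le in auto)
    \<comment> \<open>Countable subadditivity is used for each \<open>\<mu>\<close> separately, so
      none is required of the capacity.\<close>
    have "measure \<mu> (U N) \<le> (\<Sum>n. measure \<mu> (G (n + N)))"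
      unfolding U_def using Gm summ by (intro finite_measure_subadditive_countably) auto
    also have "\<dots> \<le> 2 * ((1 / 2) ^ N * e)"
      using suminf_le[OF le summ sums_summable[OF sums]] sums_unique[OF sums] by simp
    finally show "measure \<mu> (U N) \<le> 2 * (1 / 2) ^ N * e" by simp
  qed simp
  \<comment> \<open>A Borel--Cantelli limsup: a point outside \<open>E\<close> avoids all
    \<open>G n\<close> from some index on, while \<open>E\<close> lies in open sets
    \<open>U N\<close> of arbitrarily small capacity.\<close>
  define E where "E = (\<Inter>N. U N)"
  have EU: "E \<subseteq> U N" for N by (auto simp: E_def)
  have "U N \<in> sets borel" for N
  proof -
    obtain T where "open T" "U N = sphere 0 1 \<inter> T"
      using Uopen[of N] unfolding openin_open by blast
    then show ?thesis by simp
  qed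
  then have Eb: "E \<in> sets borel"
    unfolding E_def by (intro sets.countable_INT) auto
  have Es: "E \<subseteq> sphere 0 1"
    using EU[of 0] openin_imp_subset[OF Uopen] by blast
  have "outer_cap E \<le> ennreal ((2 * (1 / 2) ^ N)\<^sup>2)" for N
  proof -
    have "outer_cap E \<le> inner_cap (U N)"
      unfolding outer_cap_def using Uopen EU by (intro INF_lower) auto
    then show ?thesis using capU[of N] by (rule order_trans)
  qed
  moreover have "(\<lambda>N. ennreal ((2 * (1 / 2) ^ N)\<^sup>2)) \<longlonglongrightarrow> ennreal ((2 * 0)\<^sup>2)"
    by (intro tendsto_ennrealI tendsto_power tendsto_mult tendsto_const LIMSEQ_power_zero) simp
  ultimately have "outer_cap E \<le> ennreal ((2 * 0)\<^sup>2)"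
    by (intro LIMSEQ_le_const) auto
  then have cap: "outer_cap E = 0" by simp
  have "\<exists>l. has_koranyi_limit f l \<zeta>" if "\<zeta> \<in> sphere 0 1 - E" for \<zeta>
  proof -
    from that have \<zeta>: "\<zeta> \<in> sphere 0 1" and "\<zeta> \<notin> E" by auto
    then obtain N where N: "\<And>n. \<zeta> \<notin> G (n + N)"
      by (auto simp: E_def U_def)
    show ?thesis
    proof (rule has_koranyi_limit_approx[OF \<zeta> holomorphic_on_vec_continuous[OF hol] g(2)[OF \<zeta>]])
      show "t \<longlonglongrightarrow> 0"
        unfolding t_def using LIMSEQ_inverse_real_of_nat by (simp add: inverse_eq_divide)
      fix n z assume n: "N \<le> n" and z: "z \<in> koranyi_region (real n + 2) \<zeta>"
      then have "0 \<le> 1 - (norm z)\<^sup>2"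
        by (simp add: koranyi_region_def abs_square_le_1)
      then show "cmod (f z - g n z) \<le> t n"
        using N[of "n - N"] n z \<zeta> by (auto simp: G_def koranyi_shadow_def \<alpha>_def not_less)
    qed
  qed
  then show ?thesis using Eb Es cap by blast
qed

end
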